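(* Let $M\subset\mathbb R^4$ be a generic smooth surface, $\pi$ a 2-plane with $\dim(T_pM\cap\pi)=1$, and consider $p\in M$ such that the singularity of $P_\pi$ at $p$ is of Type 3 or worse with $j^2P_\pi\sim_{\mathcal A^{(2)}}(y,xy)$. (i) If $P_\pi$ at $p$ is of Type 3, then the apparent contour has a $(2,3)$-cusp singularity. (ii) If $P_\pi$ at $p$ is of Type 5, then the apparent contour has a $(3,4)$-cusp singularity. (iii) If $P_\pi$ at $p$ is of Type 6 or worse, then the apparent contour has a $(4,5)$-cusp singularity or worse.
   Context: Setting. With $p$ at the origin, $M$ is in Monge form $F(x,y)=(x,y,f^1(x,y),f^2(x,y))$ with $f^1,f^2$ having zero 1-jet. "Generic" means: for a residual set of immersions of $M$ in $\mathbb R^4$. The plane $\pi$ is spanned by $(1,\alpha,0,0)\in T_pM\cap\pi$ and $(0,\lambda,\mu,\beta)$, $\mu^2+\beta^2\neq0$, and the projection along $\pi$ is the germ $P_\pi(x,y)=\big(y-\alpha x-\tfrac{\lambda}{\mu^2+\beta^2}(\mu f^1+\beta f^2),\ \beta f^1-\mu f^2\big)$. $\mathcal A$-equivalence is smooth coordinate change in source and target, $\mathcal A^{(2)}$-equivalence its action on 2-jets. The singular set $\Sigma_\pi$ of $P_\pi$ is here a regular curve, and the apparent contour is $P_\pi(\Sigma_\pi)$, regarded as the plane curve germ given by $P_\pi$ restricted to a regular parametrisation of $\Sigma_\pi$. $\mathcal A$-types: Type 3 (cusp) $(x,xy+y^3)$; Type 5 (swallowtail) $(x,xy+y^4)$;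 Type 6 (butterfly) $(x,xy+y^5\pm y^7)$; Type 7 $(x,xy+y^5)$; Type 8 $(x,xy+y^6\pm y^8+ay^9)$; Type 9 $(x,xy+y^6+y^9)$; Type 10 $(x,xy+y^7\pm y^9+ay^{10}+by^{11})$ ($a,b$ moduli). "Type 6 or worse" means Types 6 to 10. A map germ $\gamma:(\mathbb R,0)\to(\mathbb R^2,0)$ has a $(k,\ell)$-cusp singularity if it is $\mathcal A$-equivalent to $t\mapsto(t^k,t^\ell)$. It is said to have a $(4,5)$-cusp or worse when $\gamma'(0)=\gamma''(0)=\gamma'''(0)=0$. *)

theory Defs
  imports "HOL-Analysis.Analysis"
begin

section \<open>Smooth maps, germs and jets\<close>

text \<open>
  \<open>iter_deriv [v\<^sub>1, \<dots>, v\<^sub>k] f x\<close> is the \<open>k\<close>-th derivative of \<open>f\<close> at \<open>x\<close> applied to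
  \<open>v\<^sub>1, \<dots>, v\<^sub>k\<close>. It is meaningful only where the derivatives exist.
\<close>

primrec iter_deriv ::
  "'a list \<Rightarrow> ('a::real_normed_vector \<Rightarrow> 'b::real_normed_vector) \<Rightarrow> 'a \<Rightarrow> 'b" where
  "iter_deriv [] f = f"
| "iter_deriv (v # vs) f = (\<lambda>x. frechet_derivative (iter_deriv vs f) (at x) v)"

text \<open>To be used for open \<open>S\<close> only.\<close>

definition smooth_on ::
  "'a::real_normed_vector set \<Rightarrow> ('a \<Rightarrow> 'b::real_normed_vector) \<Rightarrow> bool" where
  "smooth_on S f \<longleftrightarrow> (\<forall>vs. \<forall>x\<in>S. iter_deriv vs f differentiable (at x))"

text \<open>A germ at \<open>0\<close> is represented by any total function that agrees with it near \<open>0\<close>.\<close>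

definition smooth_germ :: "('a::real_normed_vector \<Rightarrow> 'b::real_normed_vector) \<Rightarrow> bool" where
  "smooth_germ f \<longleftrightarrow> (\<exists>U. open U \<and> 0 \<in> U \<and> smooth_on U f)"

definition diffeo_germ :: "('a::real_normed_vector \<Rightarrow> 'a) \<Rightarrow> bool" where
  "diffeo_germ \<phi> \<longleftrightarrow> smooth_germ \<phi> \<and> \<phi> 0 = 0 \<and>
     (\<exists>\<psi>. smooth_germ \<psi> \<and> \<psi> 0 = 0 \<and>
        (\<forall>\<^sub>F x in nhds 0. \<psi> (\<phi> x) = x) \<and> (\<forall>\<^sub>F x in nhds 0. \<phi> (\<psi> x) = x))"

definition same_jet ::
  "nat \<Rightarrow> ('a::real_normed_vector \<Rightarrow> 'b::real_normed_vector) \<Rightarrow> ('a \<Rightarrow> 'b) \<Rightarrow> bool" where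
  "same_jet k f g \<longleftrightarrow> (\<forall>vs. length vs \<le> k \<longrightarrow> iter_deriv vs f 0 = iter_deriv vs g 0)"

definition A_equiv ::
  "('a::real_normed_vector \<Rightarrow> 'b::real_normed_vector) \<Rightarrow> ('a \<Rightarrow> 'b) \<Rightarrow> bool" where
  "A_equiv f g \<longleftrightarrow> (\<exists>\<phi> \<psi>. diffeo_germ \<phi> \<and> diffeo_germ \<psi> \<and>
     (\<forall>\<^sub>F x in nhds 0. \<psi> (f (\<phi> x)) = g x))"

definition A_jet_equiv ::
  "nat \<Rightarrow> ('a::real_normed_vector \<Rightarrow> 'b::real_normed_vector) \<Rightarrow> ('a \<Rightarrow> 'b) \<Rightarrow> bool" where
  "A_jet_equiv k f g \<longleftrightarrow> (\<exists>\<phi> \<psi>. diffeo_germ \<phi> \<and> diffeo_germ \<psi> \<and>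
     same_jet k (\<psi> \<circ> f \<circ> \<phi>) g)"

section \<open>Smooth surfaces and generic immersions\<close>

type_synonym R2 = "real \<times> real"
type_synonym R4 = "real \<times> real \<times> real \<times> real"

text \<open>A chart is a pair of an open set and a map whose values outside that set are irrelevant.\<close>

type_synonym 'm chart = "'m set \<times> ('m \<Rightarrow> R2)"

definition is_chart :: "('m::topological_space) chart \<Rightarrow> bool" where
  "is_chart = (\<lambda>(U, \<phi>). open U \<and> open (\<phi> ` U) \<and> (\<exists>\<psi>. homeomorphism U (\<phi> ` U) \<phi> \<psi>))"

definition compatible :: "'m chart \<Rightarrow> 'm chart \<Rightarrow> bool" where
  "compatible = (\<lambda>(U, \<phi>) (V, \<psi>).
     smooth_on (\<phi> ` (U \<inter> V)) (\<psi> \<circ> inv_into U \<phi>) \<and>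
     smooth_on (\<psi> ` (U \<inter> V)) (\<phi> \<circ> inv_into V \<psi>))"

definition smooth_surface :: "('m::{t2_space,second_countable_topology}) chart set \<Rightarrow> bool" where
  "smooth_surface \<A> \<longleftrightarrow>
     (\<forall>c\<in>\<A>. is_chart c) \<and> (\<Union>c\<in>\<A>. fst c) = UNIV \<and> (\<forall>c\<in>\<A>. \<forall>d\<in>\<A>. compatible c d)"

text \<open>The maximal atlas generated by \<open>\<A>\<close>.\<close>

definition smooth_charts :: "('m::topological_space) chart set \<Rightarrow> 'm chart set" where
  "smooth_charts \<A> = {c. is_chart c \<and> (\<forall>d\<in>\<A>. compatible c d)}"

definition in_chart :: "('m \<Rightarrow> 'b) \<Rightarrow> 'm chart \<Rightarrow> R2 \<Rightarrow> 'b" where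
  "in_chart g = (\<lambda>(U, \<phi>). g \<circ> inv_into U \<phi>)"

definition smooth_maps :: "('m::topological_space) chart set \<Rightarrow> ('m \<Rightarrow> R4) set" where
  "smooth_maps \<A> = {g. \<forall>(U, \<phi>)\<in>\<A>. smooth_on (\<phi> ` U) (in_chart g (U, \<phi>))}"

definition immersions :: "('m::topological_space) chart set \<Rightarrow> ('m \<Rightarrow> R4) set" where
  "immersions \<A> = {g \<in> smooth_maps \<A>.
     \<forall>(U, \<phi>)\<in>\<A>. \<forall>x\<in>\<phi> ` U. inj (frechet_derivative (in_chart g (U, \<phi>)) (at x))}"

text \<open>
  Basic neighbourhoods of the Whitney (strong) \<open>C\<^sup>\<infinity>\<close> topology: closeness to \<open>f\<close> of all
  derivatives up to order \<open>r\<close>, within \<open>\<epsilon> i\<close> on the compact set \<open>K i\<close>, for a locally finite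
  family \<open>c\<close> of charts. By second countability families indexed by the naturals are enough
  (with \<open>(\<emptyset>, _)\<close> as dummy chart).
\<close>

definition locally_finite_charts :: "(nat \<Rightarrow> ('m::topological_space) chart) \<Rightarrow> bool" where
  "locally_finite_charts c \<longleftrightarrow>
     (\<forall>p. \<exists>V. open V \<and> p \<in> V \<and> finite {i. V \<inter> fst (c i) \<noteq> {}})"

definition whitney_nbhd ::
  "('m::topological_space) chart set \<Rightarrow> nat \<Rightarrow> (nat \<Rightarrow> 'm chart) \<Rightarrow> (nat \<Rightarrow> 'm set) \<Rightarrow>
   (nat \<Rightarrow> real) \<Rightarrow> ('m \<Rightarrow> R4) \<Rightarrow> ('m \<Rightarrow> R4) set" where
  "whitney_nbhd \<A> r c K \<epsilon> f = {g \<in> smooth_maps \<A>.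
     \<forall>i. \<forall>x\<in>snd (c i) ` K i. \<forall>vs. length vs \<le> r \<and> (\<forall>v\<in>set vs. norm v \<le> 1) \<longrightarrow>
       norm (iter_deriv vs (in_chart g (c i)) x - iter_deriv vs (in_chart f (c i)) x) < \<epsilon> i}"

definition whitney_topology :: "('m::topological_space) chart set \<Rightarrow> ('m \<Rightarrow> R4) topology" where
  "whitney_topology \<A> = topology_generated_by
     {whitney_nbhd \<A> r c K \<epsilon> f | r c K \<epsilon> f.
        f \<in> smooth_maps \<A> \<and> range c \<subseteq> smooth_charts \<A> \<and> locally_finite_charts c \<and>
        (\<forall>i. compact (K i) \<and> K i \<subseteq> fst (c i) \<and> \<epsilon> i > 0)}"

definition immersion_space :: "('m::topological_space) chart set \<Rightarrow> ('m \<Rightarrow> R4) topology" where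
  "immersion_space \<A> = subtopology (whitney_topology \<A>) (immersions \<A>)"

definition residual_in :: "'a topology \<Rightarrow> 'a set \<Rightarrow> bool" where
  "residual_in X R \<longleftrightarrow> R \<subseteq> topspace X \<and>
     (\<exists>\<W>. countable \<W> \<and> (\<forall>W\<in>\<W>. openin X W \<and> X closure_of W = topspace X) \<and>
        topspace X \<inter> \<Inter>\<W> \<subseteq> R)"

lemma topspace_whitney_topology: "topspace (whitney_topology \<A>) = smooth_maps \<A>"
proof
  show "topspace (whitney_topology \<A>) \<subseteq> smooth_maps \<A>"
    by (auto simp: whitney_topology_def whitney_nbhd_def)
  show "smooth_maps \<A> \<subseteq> topspace (whitney_topology \<A>)"
  proof
    fix f assume f: "f \<in> smooth_maps \<A>"
    define c :: "nat \<Rightarrow> 'a chart" where "c = (\<lambda>_. ({}, \<lambda>_. 0))"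
    have "range c \<subseteq> smooth_charts \<A>"
      by (auto simp: c_def smooth_charts_def is_chart_def compatible_def smooth_on_def
            homeomorphism_def)
    moreover have "locally_finite_charts c"
      by (auto simp: c_def locally_finite_charts_def)
    moreover have "f \<in> whitney_nbhd \<A> 0 c (\<lambda>_. {}) (\<lambda>_. 1) f"
      using f by (simp add: whitney_nbhd_def)
    ultimately show "f \<in> topspace (whitney_topology \<A>)"
      using f unfolding whitney_topology_def topology_generated_by_topspace
      by (intro UnionI[of "whitney_nbhd \<A> 0 c (\<lambda>_. {}) (\<lambda>_. 1) f"] CollectI
            exI[of _ 0] exI[of _ c] exI[of _ "\<lambda>_. {}"] exI[of _ "\<lambda>_. 1"] exI[of _ f]) auto
  qed
qed

lemma topspace_immersion_space: "topspace (immersion_space \<A>) = immersions \<A>"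
  by (auto simp: immersion_space_def topspace_whitney_topology immersions_def)

section \<open>Monge form and projection along a plane\<close>

text \<open>The union does not depend on the chart: all charts at \<open>p\<close> give the same plane.\<close>

definition tangent_plane ::
  "('m::topological_space) chart set \<Rightarrow> ('m \<Rightarrow> R4) \<Rightarrow> 'm \<Rightarrow> R4 set" where
  "tangent_plane \<A> g p =
     (\<Union>(U, \<phi>)\<in>{(U, \<phi>)\<in>\<A>. p \<in> U}. range (frechet_derivative (in_chart g (U, \<phi>)) (at (\<phi> p))))"

text \<open>
  After the rigid motion \<open>z \<mapsto> T (z - g p)\<close> the surface is near \<open>p\<close> the graph
  \<open>(x, y, f\<^sub>1(x,y), f\<^sub>2(x,y))\<close>, where \<open>(x, y) = \<phi> q\<close> is a smooth chart centred at \<open>p\<close>.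
\<close>

definition monge_form ::
  "('m::topological_space) chart set \<Rightarrow> ('m \<Rightarrow> R4) \<Rightarrow> 'm \<Rightarrow> (R4 \<Rightarrow> R4) \<Rightarrow>
   (R2 \<Rightarrow> real) \<Rightarrow> (R2 \<Rightarrow> real) \<Rightarrow> bool" where
  "monge_form \<A> g p T f1 f2 \<longleftrightarrow> orthogonal_transformation T \<and>
     smooth_germ f1 \<and> smooth_germ f2 \<and> same_jet 1 f1 (\<lambda>_. 0) \<and> same_jet 1 f2 (\<lambda>_. 0) \<and>
     (\<exists>(U, \<phi>)\<in>smooth_charts \<A>. p \<in> U \<and> \<phi> p = 0 \<and>
        (\<forall>q\<in>U. T (g q - g p) = (fst (\<phi> q), snd (\<phi> q), f1 (\<phi> q), f2 (\<phi> q))))"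

definition proj_germ ::
  "real \<Rightarrow> real \<Rightarrow> real \<Rightarrow> real \<Rightarrow> (R2 \<Rightarrow> real) \<Rightarrow> (R2 \<Rightarrow> real) \<Rightarrow> R2 \<Rightarrow> R2" where
  "proj_germ \<alpha> l \<mu> \<beta> f1 f2 = (\<lambda>(x, y).
     (y - \<alpha> * x - l / (\<mu>\<^sup>2 + \<beta>\<^sup>2) * (\<mu> * f1 (x, y) + \<beta> * f2 (x, y)),
      \<beta> * f1 (x, y) - \<mu> * f2 (x, y)))"

section \<open>Singularity types and apparent contours\<close>

definition type3 :: "(R2 \<Rightarrow> R2) \<Rightarrow> bool" where
  "type3 P \<longleftrightarrow> A_equiv P (\<lambda>(x, y). (x, x * y + y ^ 3))"

definition type5 :: "(R2 \<Rightarrow> R2) \<Rightarrow> bool" where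
  "type5 P \<longleftrightarrow> A_equiv P (\<lambda>(x, y). (x, x * y + y ^ 4))"

definition type6 :: "(R2 \<Rightarrow> R2) \<Rightarrow> bool" where
  "type6 P \<longleftrightarrow> (\<exists>s\<in>{1, -1}. A_equiv P (\<lambda>(x, y). (x, x * y + y ^ 5 + s * y ^ 7)))"

definition type7 :: "(R2 \<Rightarrow> R2) \<Rightarrow> bool" where
  "type7 P \<longleftrightarrow> A_equiv P (\<lambda>(x, y). (x, x * y + y ^ 5))"

definition type8 :: "(R2 \<Rightarrow> R2) \<Rightarrow> bool" where
  "type8 P \<longleftrightarrow> (\<exists>s\<in>{1, -1}. \<exists>a.
     A_equiv P (\<lambda>(x, y). (x, x * y + y ^ 6 + s * y ^ 8 + a * y ^ 9)))"

definition type9 :: "(R2 \<Rightarrow> R2) \<Rightarrow> bool" where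
  "type9 P \<longleftrightarrow> A_equiv P (\<lambda>(x, y). (x, x * y + y ^ 6 + y ^ 9))"

definition type10 :: "(R2 \<Rightarrow> R2) \<Rightarrow> bool" where
  "type10 P \<longleftrightarrow> (\<exists>s\<in>{1, -1}. \<exists>a b.
     A_equiv P (\<lambda>(x, y). (x, x * y + y ^ 7 + s * y ^ 9 + a * y ^ 10 + b * y ^ 11)))"

definition type6_or_worse :: "(R2 \<Rightarrow> R2) \<Rightarrow> bool" where
  "type6_or_worse P \<longleftrightarrow> type6 P \<or> type7 P \<or> type8 P \<or> type9 P \<or> type10 P"

text \<open>
  Only the types with 2-jet equivalent to \<open>(y, xy)\<close>: the remaining ones, such as lips and
  beaks \<open>(x, y\<^sup>3 \<plusminus> x\<^sup>2y)\<close>, do not have that 2-jet.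
\<close>

definition type3_or_worse :: "(R2 \<Rightarrow> R2) \<Rightarrow> bool" where
  "type3_or_worse P \<longleftrightarrow> type3 P \<or> type5 P \<or> type6_or_worse P"

definition singular_set :: "(R2 \<Rightarrow> R2) \<Rightarrow> R2 set" where
  "singular_set P = {z. \<not> surj (frechet_derivative P (at z))}"

text \<open>\<open>\<sigma>\<close> is an immersed germ and a homeomorphism onto a neighbourhood of \<open>0\<close> in \<open>S\<close>.\<close>

definition regular_parametrisation :: "R2 set \<Rightarrow> (real \<Rightarrow> R2) \<Rightarrow> bool" where
  "regular_parametrisation S \<sigma> \<longleftrightarrow>
     smooth_germ \<sigma> \<and> \<sigma> 0 = 0 \<and> vector_derivative \<sigma> (at 0) \<noteq> 0 \<and>
     (\<exists>\<delta>>0. \<exists>U \<tau>. open U \<and> homeomorphism {-\<delta><..<\<delta>} (S \<inter> U) \<sigma> \<tau>)"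

definition apparent_contour :: "(R2 \<Rightarrow> R2) \<Rightarrow> (real \<Rightarrow> R2) \<Rightarrow> bool" where
  "apparent_contour P \<gamma> \<longleftrightarrow> (\<exists>\<sigma>. regular_parametrisation (singular_set P) \<sigma> \<and> \<gamma> = P \<circ> \<sigma>)"

definition cusp :: "nat \<Rightarrow> nat \<Rightarrow> (real \<Rightarrow> R2) \<Rightarrow> bool" where
  "cusp k l \<gamma> \<longleftrightarrow> A_equiv \<gamma> (\<lambda>t. (t ^ k, t ^ l))"

definition cusp45_or_worse :: "(real \<Rightarrow> R2) \<Rightarrow> bool" where
  "cusp45_or_worse \<gamma> \<longleftrightarrow>
     iter_deriv [1] \<gamma> 0 = 0 \<and> iter_deriv [1, 1] \<gamma> 0 = 0 \<and> iter_deriv [1, 1, 1] \<gamma> 0 = 0"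

end

theory Submission
  imports Defs
begin

text \<open>
  Each of the types has a normal form \<open>(x, y) \<mapsto> (x, x y + q(y))\<close> with a polynomial \<open>q\<close>, called a fold
  form here: \<open>q = y\<^sup>3\<close> for Type 3, \<open>q = y\<^sup>4\<close> for Type 5, and a multiple of \<open>y\<^sup>5\<close> for Type 6 or worse.
  Its Jacobian determinant is \<open>x + q'(y)\<close>, so the singular set is the curve \<open>t \<mapsto> (- q'(t), t)\<close> and its
  image is \<open>t \<mapsto> (- q'(t), q(t) - t q'(t))\<close>, with velocity \<open>- q''(t) (1, t)\<close>. For \<open>q = y\<^sup>n\<^sup>+\<^sup>1\<close> this image is
  \<open>(- (n + 1) t\<^sup>n, - n t\<^sup>n\<^sup>+\<^sup>1)\<close>, a rescaled \<open>(n, n + 1)\<close>-cusp; if \<open>y\<^sup>5\<close> divides \<open>q\<close>, then \<open>t\<^sup>3\<close> divides the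
  velocity and the 3-jet of the image vanishes.

  It remains to transport these facts along an equivalence \<open>\<psi> \<circ> P \<circ> \<phi> = fold_form q\<close>. The
  diffeomorphisms carry the singular set of \<open>P\<close> to that of the normal form (lemma
  \<open>singular_set_iff\<close>), which yields one regular parametrisation and hence an apparent contour. Any
  other regular parametrisation differs from this one by a diffeomorphism of the line (lemma
  \<open>regular_parametrisation_unique\<close>), so every apparent contour is the image curve of the normal
  form up to diffeomorphisms of line and plane (lemma \<open>apparent_contour_normal_form\<close>). A cusp type is
  invariant under such changes by definition; for the vanishing 3-jet the chain rule is used.

  The analytic basis is a calculus of smooth maps: closure under products, composition and local
  inversion on the line, each by induction on the order of differentiability.
\<close>

section \<open>Calculus of smooth maps\<close>

text \<open>
  Smoothness quantifies over all lists of directions at once; cutting at a length gives a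
  parameter for induction. The recursion peels off the innermost derivative, the last entry of
  the list, so that the step passes to the functions \<open>\<lambda>x. frechet_derivative f (at x) v\<close>.
\<close>

definition differentiable_upto :: "nat \<Rightarrow> 'a::real_normed_vector set \<Rightarrow> ('a \<Rightarrow> 'b::real_normed_vector) \<Rightarrow> bool" where
  "differentiable_upto n U f \<longleftrightarrow>
     (\<forall>vs. length vs \<le> n \<longrightarrow> (\<forall>x\<in>U. iter_deriv vs f differentiable (at x)))"

lemma smooth_on_iff_differentiable_upto: "smooth_on U f \<longleftrightarrow> (\<forall>n. differentiable_upto n U f)"
  unfolding smooth_on_def differentiable_upto_def by blast

lemma iter_deriv_snoc: "iter_deriv (vs @ [v]) f = iter_deriv vs (\<lambda>x. frechet_derivative f (at x) v)"
  by (induction vs) auto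

lemma differentiable_upto_0: "differentiable_upto 0 U f \<longleftrightarrow> (\<forall>x\<in>U. f differentiable (at x))"
  by (auto simp: differentiable_upto_def)

lemma differentiable_upto_Suc:
  "differentiable_upto (Suc n) U f \<longleftrightarrow>
     (\<forall>x\<in>U. f differentiable (at x)) \<and>
     (\<forall>v. differentiable_upto n U (\<lambda>x. frechet_derivative f (at x) v))"
proof (intro iffI conjI allI)
  assume *: "differentiable_upto (Suc n) U f"
  show "\<forall>x\<in>U. f differentiable (at x)"
    using *[unfolded differentiable_upto_def, rule_format, of "[]"] by simp
  fix v show "differentiable_upto n U (\<lambda>x. frechet_derivative f (at x) v)"
    unfolding differentiable_upto_def
  proof (intro allI impI ballI)
    fix vs :: "'a list" and x assume "length vs \<le> n" "x \<in> U"
    then show "iter_deriv vs (\<lambda>x. frechet_derivative f (at x) v) differentiable at x"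
      using *[unfolded differentiable_upto_def, rule_format, of "vs @ [v]"]
      by (simp add: iter_deriv_snoc)
  qed
next
  assume *: "(\<forall>x\<in>U. f differentiable (at x)) \<and>
     (\<forall>v. differentiable_upto n U (\<lambda>x. frechet_derivative f (at x) v))"
  show "differentiable_upto (Suc n) U f"
    unfolding differentiable_upto_def
  proof (intro allI impI)
    fix vs :: "'a list" assume "length vs \<le> Suc n"
    then show "\<forall>x\<in>U. iter_deriv vs f differentiable (at x)"
    proof (cases vs rule: rev_cases)
      case Nil then show ?thesis using * by simp
    next
      case (snoc ws w)
      then show ?thesis
        using * \<open>length vs \<le> Suc n\<close> by (auto simp: differentiable_upto_def iter_deriv_snoc)
    qed
  qed
qed

lemma differentiable_upto_imp_differentiable:
  "differentiable_upto n U f \<Longrightarrow> x \<in> U \<Longrightarrow> f differentiable (at x)"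
  unfolding differentiable_upto_def by (drule spec[of _ "[]"]) simp

lemma differentiable_upto_Suc_lower: "differentiable_upto (Suc n) U f \<Longrightarrow> differentiable_upto n U f"
  unfolding differentiable_upto_def by auto

lemmas has_frechet_derivative = frechet_derivative_works[THEN iffD1]

lemma has_derivative_cong_open:
  assumes "open U" "x \<in> U" "\<And>x. x \<in> U \<Longrightarrow> f x = g x"
  shows "(f has_derivative f') (at x) \<longleftrightarrow> (g has_derivative f') (at x)"
  using has_derivative_transform_within_open[OF _ assms(1,2), of f f' _ g]
    has_derivative_transform_within_open[OF _ assms(1,2), of g f' _ f] assms(3) by auto

lemma differentiable_upto_cong:
  assumes "open U" "\<And>x. x \<in> U \<Longrightarrow> f x = g x" "differentiable_upto n U f"
  shows "differentiable_upto n U g"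
proof -
  have eq: "iter_deriv vs f x = iter_deriv vs g x" if "x \<in> U" for vs x
    using that
  proof (induction vs arbitrary: x)
    case Nil then show ?case using assms by simp
  next
    case (Cons v vs)
    then show ?case
      using has_derivative_cong_open[OF assms(1), of x "iter_deriv vs f" "iter_deriv vs g"]
      by (simp add: frechet_derivative_def)
  qed
  have "iter_deriv vs f differentiable at x \<longleftrightarrow> iter_deriv vs g differentiable at x"
    if "x \<in> U" for vs x
    using has_derivative_cong_open[OF assms(1) that, of "iter_deriv vs f" "iter_deriv vs g"] eq
    by (simp add: differentiable_def)
  then show ?thesis
    using assms(3) by (simp add: differentiable_upto_def)
qed

text \<open>
  Closure of smoothness under an operation is proved by induction on the order: the rule turns a
  differentiation formula for the result into the induction step.
\<close>

lemma differentiable_upto_Suc_I: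
  assumes U: "open U" and d: "\<And>x. x \<in> U \<Longrightarrow> (f has_derivative f' x) (at x)"
    and n: "\<And>v. differentiable_upto n U (\<lambda>x. f' x v)"
  shows "differentiable_upto (Suc n) U f"
  unfolding differentiable_upto_Suc
proof (intro conjI allI ballI)
  show "f differentiable at x" if "x \<in> U" for x
    using d[OF that] by (rule differentiableI)
  fix v show "differentiable_upto n U (\<lambda>x. frechet_derivative f (at x) v)"
    by (rule differentiable_upto_cong[OF U _ n]) (simp add: frechet_derivative_at[OF d])
qed

lemma differentiable_upto_const: "open U \<Longrightarrow> differentiable_upto n U (\<lambda>x. c)"
proof (induction n arbitrary: c)
  case 0 then show ?case by (simp add: differentiable_upto_0)
next
  case (Suc n)
  show ?case
    by (rule differentiable_upto_Suc_I[OF Suc.prems has_derivative_const]) (rule Suc.IH[OF Suc.prems])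
qed

lemma differentiable_upto_bounded_linear_compose:
  assumes "open U" "bounded_linear h" "differentiable_upto n U f"
  shows "differentiable_upto n U (\<lambda>x. h (f x))"
  using assms(3)
proof (induction n arbitrary: f)
  case 0 then show ?case
    using bounded_linear.has_derivative[OF assms(2)]
    unfolding differentiable_upto_0 differentiable_def by blast
next
  case (Suc n)
  note f = Suc.prems[unfolded differentiable_upto_Suc]
  show ?case
  proof (rule differentiable_upto_Suc_I[OF assms(1)])
    show "((\<lambda>x. h (f x)) has_derivative (\<lambda>v. h (frechet_derivative f (at x) v))) (at x)"
      if "x \<in> U" for x
      using f that by (intro bounded_linear.has_derivative[OF assms(2)]) (simp add: has_frechet_derivative)
  qed (use Suc.IH f in blast)
qed

lemma differentiable_upto_bounded_linear:
  assumes "open U" "bounded_linear h"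
  shows "differentiable_upto n U h"
proof (cases n)
  case 0
  then show ?thesis
    using bounded_linear_imp_differentiable[OF assms(2)] by (simp add: differentiable_upto_0)
next
  case (Suc m)
  show ?thesis unfolding Suc
    by (rule differentiable_upto_Suc_I[OF assms(1) bounded_linear_imp_has_derivative[OF assms(2)]])
       (rule differentiable_upto_const[OF assms(1)])
qed

lemma differentiable_upto_add:
  assumes "open U" "differentiable_upto n U f" "differentiable_upto n U g"
  shows "differentiable_upto n U (\<lambda>x. f x + g x)"
  using assms(2-)
proof (induction n arbitrary: f g)
  case 0 then show ?case by (simp add: differentiable_upto_0)
next
  case (Suc n)
  note fg = Suc.prems[unfolded differentiable_upto_Suc]
  show ?case
    by (rule differentiable_upto_Suc_I[OF assms(1) has_derivative_add[OF has_frechet_derivative has_frechet_derivative]])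
       (use Suc.IH fg in auto)
qed

lemma differentiable_upto_sum:
  assumes "open U" "finite I" "\<And>i. i \<in> I \<Longrightarrow> differentiable_upto n U (f i)"
  shows "differentiable_upto n U (\<lambda>x. \<Sum>i\<in>I. f i x)"
  using assms(2,3)
  by (induction I) (auto intro!: differentiable_upto_add differentiable_upto_const assms(1))

lemma differentiable_upto_bilinear:
  assumes "open U" "bounded_bilinear prd" "differentiable_upto n U f" "differentiable_upto n U g"
  shows "differentiable_upto n U (\<lambda>x. prd (f x) (g x))"
  using assms(3-)
proof (induction n arbitrary: f g)
  case 0 then show ?case
    using bounded_bilinear.FDERIV[OF assms(2)] unfolding differentiable_upto_0 differentiable_def by blast
next
  case (Suc n)
  note fg = Suc.prems[unfolded differentiable_upto_Suc]
  note lower = Suc.prems[THEN differentiable_upto_Suc_lower]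
  show ?case
    by (rule differentiable_upto_Suc_I[OF assms(1)
          bounded_bilinear.FDERIV[OF assms(2) has_frechet_derivative has_frechet_derivative]])
       (use fg lower in \<open>auto intro!: Suc.IH differentiable_upto_add[OF assms(1)]\<close>)
qed

lemma differentiable_upto_Pair:
  assumes "open U" "differentiable_upto n U f" "differentiable_upto n U g"
  shows "differentiable_upto n U (\<lambda>x. (f x, g x))"
proof -
  have "bounded_linear (\<lambda>y. (y, 0))" "bounded_linear (\<lambda>y. (0, y))"
    by (intro bounded_linear_Pair bounded_linear_ident bounded_linear_zero)+
  from this[THEN differentiable_upto_bounded_linear_compose[OF assms(1)]] assms(2,3)
  have "differentiable_upto n U (\<lambda>x. (f x, 0) + (0, g x))"
    by (intro differentiable_upto_add[OF assms(1)]) auto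
  then show ?thesis by simp
qed

text \<open>
  Expanding the inner derivative in a basis writes the derivative of \<open>g \<circ> f\<close> as a sum of
  products of a directional derivative of \<open>f\<close> and a directional derivative of \<open>g\<close>, along a fixed
  vector, composed with \<open>f\<close>. Such a sum is covered by an induction hypothesis on the order.
\<close>

lemma has_derivative_compose_Basis:
  fixes f :: "'a::real_normed_vector \<Rightarrow> 'b::euclidean_space" and g :: "'b \<Rightarrow> 'c::real_normed_vector"
  assumes "f differentiable at x" "g differentiable at (f x)"
  shows "((\<lambda>x. g (f x)) has_derivative
     (\<lambda>v. \<Sum>b\<in>Basis. (frechet_derivative f (at x) v \<bullet> b) *\<^sub>R frechet_derivative g (at (f x)) b)) (at x)"
proof -
  interpret linear "frechet_derivative g (at (f x))"
    by (rule linear_frechet_derivative[OF assms(2)])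
  have "frechet_derivative g (at (f x)) (frechet_derivative f (at x) v) =
      (\<Sum>b\<in>Basis. (frechet_derivative f (at x) v \<bullet> b) *\<^sub>R frechet_derivative g (at (f x)) b)" for v
  proof -
    have "frechet_derivative g (at (f x)) (\<Sum>b\<in>Basis. (frechet_derivative f (at x) v \<bullet> b) *\<^sub>R b) =
        (\<Sum>b\<in>Basis. (frechet_derivative f (at x) v \<bullet> b) *\<^sub>R frechet_derivative g (at (f x)) b)"
      by (simp only: sum scaleR)
    then show ?thesis by (simp only: euclidean_representation)
  qed
  then show ?thesis
    using diff_chain_at[OF has_frechet_derivative[OF assms(1)] has_frechet_derivative[OF assms(2)]]
    by (simp only: o_def)
qed

lemma differentiable_upto_compose:
  fixes f :: "'a::real_normed_vector \<Rightarrow> 'b::euclidean_space" and g :: "'b \<Rightarrow> 'c::real_normed_vector"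
  assumes "open U" "f ` U \<subseteq> V" "differentiable_upto n U f" "differentiable_upto n V g"
  shows "differentiable_upto n U (\<lambda>x. g (f x))"
  using assms(3-)
proof (induction n arbitrary: g)
  case 0
  show ?case unfolding differentiable_upto_0
  proof
    fix x assume "x \<in> U"
    then have "f differentiable at x" "g differentiable at (f x)"
      using 0 assms(2) by (auto simp: differentiable_upto_0)
    then show "(\<lambda>x. g (f x)) differentiable at x"
      by (rule differentiableI[OF has_derivative_compose_Basis])
  qed
next
  case (Suc n)
  note f = differentiable_upto_Suc_lower[OF Suc.prems(1)]
  show ?case
  proof (rule differentiable_upto_Suc_I[OF assms(1) has_derivative_compose_Basis])
    fix x assume "x \<in> U"
    then show "f differentiable at x" "g differentiable at (f x)"
      using Suc.prems assms(2) by (auto simp: differentiable_upto_Suc)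
  next
    fix v
    have "differentiable_upto n U (\<lambda>x. frechet_derivative f (at x) v)"
      using Suc.prems(1) by (simp add: differentiable_upto_Suc)
    then have 1: "differentiable_upto n U (\<lambda>x. frechet_derivative f (at x) v \<bullet> b)" for b
      by (rule differentiable_upto_bounded_linear_compose[OF assms(1) bounded_linear_inner_left])
    have "differentiable_upto n V (\<lambda>y. frechet_derivative g (at y) b)" for b
      using Suc.prems(2) by (simp add: differentiable_upto_Suc)
    from Suc.IH[OF f this]
    have 2: "differentiable_upto n U (\<lambda>x. frechet_derivative g (at (f x)) b)" for b .
    show "differentiable_upto n U (\<lambda>x. \<Sum>b\<in>Basis.
       (frechet_derivative f (at x) v \<bullet> b) *\<^sub>R frechet_derivative g (at (f x)) b)"
      by (rule differentiable_upto_sum[OF assms(1) finite_Basis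
           differentiable_upto_bilinear[OF assms(1) bounded_bilinear_scaleR 1 2]])
  qed
qed

lemma differentiable_upto_inverse: "differentiable_upto n (- {0}) (inverse :: real \<Rightarrow> real)"
proof (induction n)
  case 0
  have "(inverse :: real \<Rightarrow> real) differentiable at x" if "x \<noteq> 0" for x
    by (rule differentiableI[OF has_derivative_inverse'[OF that]])
  then show ?case by (simp add: differentiable_upto_0)
next
  case (Suc n)
  have U: "open (- {0::real})" by (simp add: open_Compl)
  show ?case
  proof (rule differentiable_upto_Suc_I[OF U])
    show "((inverse :: real \<Rightarrow> real) has_derivative (\<lambda>v. - (inverse x * v * inverse x))) (at x)"
      if "x \<in> - {0}" for x
      using that by (intro has_derivative_inverse') simp
    fix v :: real
    have "differentiable_upto n (- {0}) (\<lambda>x. inverse x * v)"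
      by (rule differentiable_upto_bilinear[OF U bounded_bilinear_mult])
        (rule Suc.IH differentiable_upto_const[OF U])+
    then have "differentiable_upto n (- {0}) (\<lambda>x. inverse x * v * inverse x)"
      by (rule differentiable_upto_bilinear[OF U bounded_bilinear_mult]) (rule Suc.IH)
    then show "differentiable_upto n (- {0}) (\<lambda>x. - (inverse x * v * inverse x))"
      by (rule differentiable_upto_bounded_linear_compose[OF U bounded_linear_minus[OF bounded_linear_ident]])
  qed
qed

lemma differentiable_upto_poly: "differentiable_upto n UNIV (poly p :: real \<Rightarrow> real)"
proof (induction p)
  case 0
  have "poly 0 = (\<lambda>x::real. 0)" by auto
  then show ?case using differentiable_upto_const[OF open_UNIV] by metis
next
  case (pCons a p)
  have "differentiable_upto n UNIV (\<lambda>x. x * poly p x)"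
    by (rule differentiable_upto_bilinear[OF open_UNIV bounded_bilinear_mult])
       (rule differentiable_upto_bounded_linear[OF open_UNIV bounded_linear_ident] pCons.IH)+
  then have "differentiable_upto n UNIV (\<lambda>x. a + x * poly p x)"
    by (rule differentiable_upto_add[OF open_UNIV, rotated]) (rule differentiable_upto_const[OF open_UNIV])
  moreover have "poly (pCons a p) = (\<lambda>x. a + x * poly p x)" by auto
  ultimately show ?case by simp
qed

text \<open>
  The derivative of the inverse is \<open>1 / s' (r y)\<close>, where \<open>r\<close> occurs undifferentiated, so each order
  of differentiability of \<open>r\<close> yields the next one.
\<close>

lemma smooth_on_real_local_inverse:
  fixes s r :: "real \<Rightarrow> real"
  assumes "open V" "smooth_on U s" "r ` V \<subseteq> U" "continuous_on V r"
    "\<And>y. y \<in> V \<Longrightarrow> s (r y) = y" "\<And>x. x \<in> U \<Longrightarrow> frechet_derivative s (at x) 1 \<noteq> 0"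
  shows "smooth_on V r"
proof -
  define s' where "s' x = frechet_derivative s (at x) 1" for x
  have s_diff: "differentiable_upto n U s" for n using assms(2) by (simp add: smooth_on_iff_differentiable_upto)
  have s': "differentiable_upto n U s'" for n
    using s_diff[of "Suc n"] by (simp add: differentiable_upto_Suc s'_def[abs_def])
  have ds: "DERIV s x :> s' x" if "x \<in> U" for x
  proof -
    have sd: "s differentiable at x" by (rule differentiable_upto_imp_differentiable[OF s_diff[of 0] that])
    have "frechet_derivative s (at x) v = s' x * v" for v
      using linear_cmul[OF linear_frechet_derivative[OF sd], of v 1] by (simp add: s'_def mult.commute)
    then have "frechet_derivative s (at x) = (\<lambda>v. s' x * v)" ..
    then show ?thesis
      using has_frechet_derivative[OF sd] by (simp add: has_field_derivative_def)
  qed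
  have dr: "(r has_derivative (\<lambda>v. v * inverse (s' (r y)))) (at y)" if y: "y \<in> V" for y
  proof -
    from openE[OF assms(1) y] obtain e where e: "e > 0" "ball y e \<subseteq> V" .
    have ry: "r y \<in> U" using assms(3) y by (rule image_subset_iff[THEN iffD1, rule_format])
    have "DERIV r y :> inverse (s' (r y))"
    proof (rule DERIV_inverse_function)
      show "DERIV s (r y) :> s' (r y)" using ry by (rule ds)
      show "s' (r y) \<noteq> 0" using assms(6)[OF ry] by (simp add: s'_def)
      show "isCont r y" using continuous_on_interior[of V r y] assms(1,4) y by (simp add: interior_open)
      show "y - e < y" "y < y + e" using e(1) by simp_all
      fix z assume "y - e < z" "z < y + e"
      then have "z \<in> ball y e" by (simp add: dist_real_def)
      then show "s (r z) = z" using e(2) by (intro assms(5)) (rule subsetD)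
    qed
    then show ?thesis by (simp add: has_field_derivative_def mult_commute_abs)
  qed
  have "differentiable_upto n V r" for n
  proof (induction n)
    case 0
    show ?case
      unfolding differentiable_upto_0 by (intro ballI differentiableI) (rule dr)
  next
    case (Suc n)
    show ?case
    proof (rule differentiable_upto_Suc_I[OF assms(1)])
      fix y assume "y \<in> V"
      then show "(r has_derivative (\<lambda>v. v * inverse (s' (r y)))) (at y)" by (rule dr)
    next
      fix v
      have *: "differentiable_upto n V (\<lambda>y. s' (r y))"
        by (rule differentiable_upto_compose[OF assms(1,3) Suc.IH s'])
      have "(\<lambda>y. s' (r y)) ` V \<subseteq> - {0}"
        using assms(3,6) by (force simp: s'_def)
      from differentiable_upto_compose[OF assms(1) this * differentiable_upto_inverse]
      have "differentiable_upto n V (\<lambda>y. inverse (s' (r y)))" .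
      then show "differentiable_upto n V (\<lambda>y. v * inverse (s' (r y)))"
        by (rule differentiable_upto_bounded_linear_compose[OF assms(1) bounded_linear_mult_right[of v]])
    qed
  qed
  then show ?thesis by (simp add: smooth_on_iff_differentiable_upto)
qed

section \<open>Smooth germs\<close>

lemma smooth_germ_iff:
  "smooth_germ f \<longleftrightarrow> (\<exists>U. open U \<and> 0 \<in> U \<and> (\<forall>n. differentiable_upto n U f))"
  by (simp add: smooth_germ_def smooth_on_iff_differentiable_upto)

lemma differentiable_upto_subset: "differentiable_upto n U f \<Longrightarrow> V \<subseteq> U \<Longrightarrow> differentiable_upto n V f"
  unfolding differentiable_upto_def by blast

lemma smooth_germ_differentiable:
  assumes "smooth_germ f" shows "\<forall>\<^sub>F x in nhds 0. f differentiable (at x)"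
proof -
  obtain U where U: "open U" "0 \<in> U" "\<And>n. differentiable_upto n U f"
    using assms by (auto simp: smooth_germ_iff)
  show ?thesis
    unfolding eventually_nhds using U differentiable_upto_imp_differentiable[OF U(3)]
    by (intro exI[of _ U]) simp
qed

lemma smooth_germ_isCont: "smooth_germ f \<Longrightarrow> isCont f 0"
  using eventually_nhds_x_imp_x[OF smooth_germ_differentiable] by (rule differentiable_imp_continuous_within)

lemma smooth_germ_derivative:
  assumes "smooth_germ f" shows "smooth_germ (\<lambda>x. frechet_derivative f (at x) v)"
proof -
  obtain U where U: "open U" "0 \<in> U" "\<And>n. differentiable_upto n U f"
    using assms by (auto simp: smooth_germ_iff)
  have "differentiable_upto n U (\<lambda>x. frechet_derivative f (at x) v)" for n
    using U(3)[of "Suc n"] by (simp add: differentiable_upto_Suc)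
  then show ?thesis
    unfolding smooth_germ_iff using U(1,2) by blast
qed

lemma smooth_germ_const: "smooth_germ (\<lambda>x. c)"
  unfolding smooth_germ_iff by (intro exI[of _ UNIV]) (simp add: differentiable_upto_const)

lemma smooth_germ_bounded_linear: "bounded_linear h \<Longrightarrow> smooth_germ h"
  unfolding smooth_germ_iff by (intro exI[of _ UNIV]) (simp add: differentiable_upto_bounded_linear)

lemma smooth_germ_poly: "smooth_germ (poly p :: real \<Rightarrow> real)"
  unfolding smooth_germ_iff by (intro exI[of _ UNIV]) (simp add: differentiable_upto_poly)

lemma smooth_germ_both:
  assumes "smooth_germ f" "smooth_germ g"
  shows "\<exists>U. open U \<and> 0 \<in> U \<and> (\<forall>n. differentiable_upto n U f) \<and> (\<forall>n. differentiable_upto n U g)"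
proof -
  obtain U where U: "open U" "0 \<in> U" "\<And>n. differentiable_upto n U f"
    using assms by (auto simp: smooth_germ_iff)
  obtain V where V: "open V" "0 \<in> V" "\<And>n. differentiable_upto n V g"
    using assms by (auto simp: smooth_germ_iff)
  show ?thesis
    by (rule exI[of _ "U \<inter> V"]) (simp_all add: U V open_Int differentiable_upto_subset[OF U(3)]
        differentiable_upto_subset[OF V(3)])
qed

lemma smooth_germ_add:
  assumes "smooth_germ f" "smooth_germ g" shows "smooth_germ (\<lambda>x. f x + g x)"
proof -
  obtain U where U: "open U" "0 \<in> U" "\<And>n. differentiable_upto n U f" "\<And>n. differentiable_upto n U g"
    using smooth_germ_both[OF assms] by auto
  show ?thesis
    unfolding smooth_germ_iff using differentiable_upto_add[OF U(1) U(3,4)] U(1,2) by blast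
qed

lemma smooth_germ_bilinear:
  assumes "bounded_bilinear prd" "smooth_germ f" "smooth_germ g"
  shows "smooth_germ (\<lambda>x. prd (f x) (g x))"
proof -
  obtain U where U: "open U" "0 \<in> U" "\<And>n. differentiable_upto n U f" "\<And>n. differentiable_upto n U g"
    using smooth_germ_both[OF assms(2,3)] by auto
  show ?thesis
    unfolding smooth_germ_iff using differentiable_upto_bilinear[OF U(1) assms(1) U(3,4)] U(1,2) by blast
qed

lemmas smooth_germ_mult = smooth_germ_bilinear[OF bounded_bilinear_mult]
lemmas smooth_germ_scaleR = smooth_germ_bilinear[OF bounded_bilinear_scaleR]

lemma smooth_germ_Pair:
  assumes "smooth_germ f" "smooth_germ g" shows "smooth_germ (\<lambda>x. (f x, g x))"
proof -
  obtain U where U: "open U" "0 \<in> U" "\<And>n. differentiable_upto n U f" "\<And>n. differentiable_upto n U g"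
    using smooth_germ_both[OF assms] by auto
  show ?thesis
    unfolding smooth_germ_iff using differentiable_upto_Pair[OF U(1) U(3,4)] U(1,2) by blast
qed

lemma eventually_nhds_compose:
  assumes "isCont f a" "\<forall>\<^sub>F y in nhds (f a). Q y"
  shows "\<forall>\<^sub>F x in nhds a. Q (f x)"
  using eventually_compose_filterlim[OF assms(2)] assms(1)
  by (simp add: isCont_def tendsto_at_iff_tendsto_nhds)

lemma smooth_germ_compose:
  fixes f :: "'a::real_normed_vector \<Rightarrow> 'b::euclidean_space" and g :: "'b \<Rightarrow> 'c::real_normed_vector"
  assumes "smooth_germ f" "f 0 = 0" "smooth_germ g"
  shows "smooth_germ (\<lambda>x. g (f x))"
proof -
  obtain V where V: "open V" "0 \<in> V" "\<And>n. differentiable_upto n V g"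
    using assms(3) by (auto simp: smooth_germ_iff)
  obtain U where U: "open U" "0 \<in> U" "\<And>n. differentiable_upto n U f"
    using assms(1) by (auto simp: smooth_germ_iff)
  have "\<forall>\<^sub>F y in nhds (f 0). y \<in> V"
    using V(1,2) assms(2) by (simp add: eventually_nhds_in_open)
  from eventually_nhds_compose[OF smooth_germ_isCont[OF assms(1)] this]
  obtain W where W: "open W" "0 \<in> W" "\<And>x. x \<in> W \<Longrightarrow> f x \<in> V"
    by (auto simp: eventually_nhds)
  have "f ` (U \<inter> W) \<subseteq> V" using W(3) by auto
  then have "differentiable_upto n (U \<inter> W) (\<lambda>x. g (f x))" for n
    by (rule differentiable_upto_compose[OF open_Int[OF U(1) W(1)] _ differentiable_upto_subset[OF U(3)] V(3)])
       simp
  then show ?thesis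
    unfolding smooth_germ_iff using U W by (intro exI[of _ "U \<inter> W"]) (simp add: open_Int)
qed

text \<open>
  The continuous inverse is given because a parameter change between two parametrisations of
  one curve has one, obtained from their homeomorphisms onto the curve.
\<close>

lemma smooth_germ_real_local_inverse:
  fixes s r :: "real \<Rightarrow> real"
  assumes s: "smooth_germ s" "frechet_derivative s (at 0) 1 \<noteq> 0"
    and r: "r 0 = 0" "open V" "0 \<in> V" "continuous_on V r"
    and sr: "\<forall>\<^sub>F y in nhds 0. s (r y) = y"
  shows "smooth_germ r"
proof -
  obtain U where U: "open U" "0 \<in> U" "smooth_on U s"
    using s(1) by (auto simp: smooth_germ_def)
  have "\<forall>\<^sub>F x in nhds 0. frechet_derivative s (at x) 1 \<in> - {0}"
    by (rule eventually_nhds_compose[OF smooth_germ_isCont[OF smooth_germ_derivative[OF s(1)]]])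
       (intro eventually_nhds_in_open, simp_all add: open_Compl s(2))
  then have "\<forall>\<^sub>F x in nhds 0. x \<in> U \<and> frechet_derivative s (at x) 1 \<in> - {0}"
    using U by (intro eventually_conj eventually_nhds_in_open)
  then obtain W where W: "open W" "0 \<in> W" "\<And>x. x \<in> W \<Longrightarrow> x \<in> U"
      "\<And>x. x \<in> W \<Longrightarrow> frechet_derivative s (at x) 1 \<noteq> 0"
    unfolding eventually_nhds by auto
  have "isCont r 0" using r(2-4) by (simp add: continuous_on_eq_continuous_at)
  moreover have "\<forall>\<^sub>F x in nhds (r 0). x \<in> W" using W r(1) by (simp add: eventually_nhds_in_open)
  ultimately have "\<forall>\<^sub>F y in nhds 0. r y \<in> W" by (rule eventually_nhds_compose)
  moreover have "\<forall>\<^sub>F y in nhds 0. y \<in> V" using r by (simp add: eventually_nhds_in_open)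
  ultimately have "\<forall>\<^sub>F y in nhds 0. s (r y) = y \<and> r y \<in> W \<and> y \<in> V"
    using sr by (intro eventually_conj)
  then obtain X where X: "open X" "0 \<in> X" "\<And>y. y \<in> X \<Longrightarrow> s (r y) = y \<and> r y \<in> W \<and> y \<in> V"
    unfolding eventually_nhds by blast
  have "smooth_on X r"
  proof (rule smooth_on_real_local_inverse[OF X(1)])
    show "smooth_on W s" using U(3) W(3) by (auto simp: smooth_on_def)
    show "r ` X \<subseteq> W" using X(3) by auto
    show "continuous_on X r" using X(3) by (intro continuous_on_subset[OF r(4)]) auto
  qed (use X(3) W(4) in auto)
  then show ?thesis using X(1,2) by (auto simp: smooth_germ_def)
qed

text \<open>
  A diffeomorphism germ together with a named inverse: the inverse serves to pull the
  singular set and the normal form back and forth.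
\<close>

definition inverse_germs :: "('a::real_normed_vector \<Rightarrow> 'a) \<Rightarrow> ('a \<Rightarrow> 'a) \<Rightarrow> bool" where
  "inverse_germs \<phi> \<Phi> \<longleftrightarrow> smooth_germ \<phi> \<and> smooth_germ \<Phi> \<and> \<phi> 0 = 0 \<and> \<Phi> 0 = 0 \<and>
     (\<forall>\<^sub>F x in nhds 0. \<Phi> (\<phi> x) = x) \<and> (\<forall>\<^sub>F x in nhds 0. \<phi> (\<Phi> x) = x)"

lemma diffeo_germ_iff: "diffeo_germ \<phi> \<longleftrightarrow> (\<exists>\<Phi>. inverse_germs \<phi> \<Phi>)"
  unfolding diffeo_germ_def inverse_germs_def by blast

lemma inverse_germs_bij_derivative:
  assumes "inverse_germs \<phi> \<Phi>"
  shows "\<forall>\<^sub>F x in nhds 0. \<phi> differentiable (at x) \<and> bij (frechet_derivative \<phi> (at x))"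
proof -
  note a = assms[unfolded inverse_germs_def]
  have cont: "isCont \<phi> 0" using a smooth_germ_isCont by blast
  have "\<forall>\<^sub>F x in nhds 0. \<forall>\<^sub>F x' in nhds x. \<Phi> (\<phi> x') = x'"
    using a by (simp add: eventually_eventually)
  moreover have "\<forall>\<^sub>F x in nhds (\<phi> 0). \<forall>\<^sub>F x' in nhds x. \<phi> (\<Phi> x') = x'"
    using a by (simp add: eventually_eventually)
  note eventually_nhds_compose[OF cont this]
  moreover have "\<forall>\<^sub>F x in nhds 0. \<phi> differentiable (at x)"
    using a smooth_germ_differentiable by blast
  moreover have "\<forall>\<^sub>F x in nhds (\<phi> 0). \<Phi> differentiable (at x)"
    using a smooth_germ_differentiable by metis
  note eventually_nhds_compose[OF cont this]
  ultimately show ?thesis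
  proof eventually_elim
    case (elim x)
    have id_deriv: "f' \<circ> g' = id"
      if dg: "(g has_derivative g') (at y)" and df: "(f has_derivative f') (at (g y))"
        and fg: "\<forall>\<^sub>F x' in nhds y. f (g x') = x'" for f g f' g' :: "'a \<Rightarrow> 'a" and y :: 'a
    proof -
      have "(f \<circ> g has_derivative f' \<circ> g') (at y)" using dg df by (rule diff_chain_at)
      moreover obtain W where "open W" "y \<in> W" "\<And>x'. x' \<in> W \<Longrightarrow> (f \<circ> g) x' = id x'"
        using fg by (auto simp: eventually_nhds)
      ultimately have "(id has_derivative f' \<circ> g') (at y)"
        using has_derivative_cong_open[of W y "f \<circ> g" id] by blast
      then show ?thesis using has_derivative_id has_derivative_unique by blast
    qed
    have x: "\<Phi> (\<phi> x) = x" using elim(1) by (rule eventually_nhds_x_imp_x)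
    note d\<phi> = has_frechet_derivative[OF elim(3)] and d\<Phi> = has_frechet_derivative[OF elim(4)]
    have "frechet_derivative \<Phi> (at (\<phi> x)) \<circ> frechet_derivative \<phi> (at x) = id"
      by (rule id_deriv[OF d\<phi> d\<Phi> elim(1)])
    moreover have "frechet_derivative \<phi> (at x) \<circ> frechet_derivative \<Phi> (at (\<phi> x)) = id"
      by (rule id_deriv[OF d\<Phi> _ elim(2)]) (simp add: x d\<phi>)
    ultimately show ?case using elim(3) o_bij by blast
  qed
qed

lemma inverse_germs_derivative_0:
  assumes "inverse_germs \<phi> \<Phi>"
  obtains D where "(\<phi> has_derivative D) (at 0)" "bij D"
  using eventually_nhds_x_imp_x[OF inverse_germs_bij_derivative[OF assms]]
    has_frechet_derivative[of \<phi> "at 0"] that by blast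

lemma inverse_germs_sym: "inverse_germs \<phi> \<Phi> \<Longrightarrow> inverse_germs \<Phi> \<phi>"
  by (auto simp: inverse_germs_def)

lemma inverse_germs_linear:
  assumes "bounded_linear L" "bounded_linear L'" "\<And>x. L' (L x) = x" "\<And>x. L (L' x) = x"
  shows "inverse_germs L L'"
  unfolding inverse_germs_def
  using assms by (simp add: smooth_germ_bounded_linear linear_simps)

lemma inverse_germs_compose:
  fixes \<phi> \<psi> :: "'a::euclidean_space \<Rightarrow> 'a"
  assumes "inverse_germs \<phi> \<Phi>" "inverse_germs \<psi> \<Psi>"
  shows "inverse_germs (\<lambda>x. \<psi> (\<phi> x)) (\<lambda>x. \<Phi> (\<Psi> x))"
proof -
  note a = assms(1)[unfolded inverse_germs_def] and b = assms(2)[unfolded inverse_germs_def]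
  have *: "\<forall>\<^sub>F x in nhds 0. f' (g' (g (f x))) = x"
    if "smooth_germ f" "f 0 = 0" "\<forall>\<^sub>F x in nhds 0. f' (f x) = x" "\<forall>\<^sub>F x in nhds 0. g' (g x) = x"
    for f f' g g' :: "'a \<Rightarrow> 'a"
  proof -
    have "\<forall>\<^sub>F x in nhds (f 0). g' (g x) = x" using that by simp
    from eventually_nhds_compose[OF smooth_germ_isCont[OF that(1)] this] that(3)
    show ?thesis by eventually_elim simp
  qed
  show ?thesis
    unfolding inverse_germs_def
  proof (intro conjI)
    show "smooth_germ (\<lambda>x. \<psi> (\<phi> x))" by (rule smooth_germ_compose) (use a b in simp_all)
    show "smooth_germ (\<lambda>x. \<Phi> (\<Psi> x))" by (rule smooth_germ_compose) (use a b in simp_all)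
    show "\<forall>\<^sub>F x in nhds 0. \<Phi> (\<Psi> (\<psi> (\<phi> x))) = x" by (rule *) (use a b in simp_all)
    show "\<forall>\<^sub>F x in nhds 0. \<psi> (\<phi> (\<Phi> (\<Psi> x))) = x" by (rule *) (use a b in simp_all)
  qed (use a b in simp_all)
qed

lemma inverse_germs_scale:
  assumes "a \<noteq> 0" "b \<noteq> 0"
  shows "inverse_germs (\<lambda>z::R2. (a * fst z, b * snd z)) (\<lambda>z. (fst z / a, snd z / b))"
  using assms
  by (intro inverse_germs_linear bounded_linear_Pair bounded_linear_mult_const bounded_linear_const_mult
       bounded_linear_divide bounded_linear_fst bounded_linear_snd bounded_linear_compose[OF bounded_linear_divide])
     simp_all

text \<open>
  Differentiating a multiple of \<open>s\<^sup>k\<^sup>+\<^sup>1\<close> loses one power of \<open>s\<close>. With \<open>s 0 = 0\<close>, a function of the form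
  \<open>s\<^sup>n h\<close> therefore vanishes at \<open>0\<close> with its derivatives up to order \<open>n - 1\<close>.
\<close>

lemma flat_derivative:
  fixes s :: "real \<Rightarrow> real" and f :: "real \<Rightarrow> 'a::real_normed_vector"
  assumes "smooth_germ s" "smooth_germ h" "\<forall>\<^sub>F t in nhds 0. f t = s t ^ Suc k *\<^sub>R h t"
  obtains h' where "smooth_germ h'" "\<forall>\<^sub>F t in nhds 0. frechet_derivative f (at t) 1 = s t ^ k *\<^sub>R h' t"
proof -
  define h' where "h' = (\<lambda>t. (real (Suc k) * frechet_derivative s (at t) 1) *\<^sub>R h t + s t *\<^sub>R frechet_derivative h (at t) 1)"
  have "smooth_germ (\<lambda>t. (real (Suc k) * frechet_derivative s (at t) 1) *\<^sub>R h t)"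
    by (rule smooth_germ_scaleR[OF smooth_germ_mult[OF smooth_germ_const smooth_germ_derivative[OF assms(1)]] assms(2)])
  moreover have "smooth_germ (\<lambda>t. s t *\<^sub>R frechet_derivative h (at t) 1)"
    by (rule smooth_germ_scaleR[OF assms(1) smooth_germ_derivative[OF assms(2)]])
  ultimately have "smooth_germ h'" unfolding h'_def by (rule smooth_germ_add)
  moreover have "\<forall>\<^sub>F t in nhds 0. \<forall>\<^sub>F t' in nhds t. f t' = s t' ^ Suc k *\<^sub>R h t'"
    using assms(3) by (simp add: eventually_eventually)
  with smooth_germ_differentiable[OF assms(1)] smooth_germ_differentiable[OF assms(2)]
  have "\<forall>\<^sub>F t in nhds 0. frechet_derivative f (at t) 1 = s t ^ k *\<^sub>R h' t"
  proof eventually_elim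
    case (elim t)
    obtain W where W: "open W" "t \<in> W" "\<And>t'. t' \<in> W \<Longrightarrow> f t' = s t' ^ Suc k *\<^sub>R h t'"
      using elim(3) unfolding eventually_nhds by blast
    let ?s = "frechet_derivative s (at t)" and ?h = "frechet_derivative h (at t)"
    have "((\<lambda>t'. s t' ^ Suc k *\<^sub>R h t') has_derivative
        (\<lambda>v. s t ^ Suc k *\<^sub>R ?h v + (of_nat (Suc k) * ?s v * s t ^ (Suc k - 1)) *\<^sub>R h t)) (at t)"
      by (rule has_derivative_scaleR[OF has_derivative_power[OF has_frechet_derivative[OF elim(1)]] has_frechet_derivative[OF elim(2)]])
    then have "(f has_derivative
        (\<lambda>v. s t ^ Suc k *\<^sub>R ?h v + (of_nat (Suc k) * ?s v * s t ^ (Suc k - 1)) *\<^sub>R h t)) (at t)"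
      using has_derivative_cong_open[OF W] by simp
    from fun_cong[OF frechet_derivative_at[OF this], of 1, symmetric]
    show ?case by (simp add: h'_def algebra_simps)
  qed
  ultimately show thesis by (rule that)
qed

section \<open>Fold forms and their critical curves\<close>

definition fold_form :: "real poly \<Rightarrow> R2 \<Rightarrow> R2" where
  "fold_form q = (\<lambda>(x, y). (x, x * y + poly q y))"

definition critical_curve :: "real poly \<Rightarrow> real \<Rightarrow> R2" where
  "critical_curve q t = (- poly (pderiv q) t, t)"

definition critical_values :: "real poly \<Rightarrow> real \<Rightarrow> R2" where
  "critical_values q t = fold_form q (critical_curve q t)"

lemma has_derivative_poly:
  "(poly q has_derivative (\<lambda>h. poly (pderiv q) x * h)) (at (x::real))"
  using poly_DERIV[of q x] by (simp add: has_field_derivative_def)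

lemma pderiv_monom_mult:
  "pderiv (monom (1::real) (Suc n) * p) = monom 1 n * (smult (real (Suc n)) p + monom 1 1 * pderiv p)"
proof -
  have "pderiv (monom (1::real) (Suc n)) = smult (real (Suc n)) (monom 1 n)"
    by (simp add: pderiv_monom smult_monom)
  moreover have "monom (1::real) (Suc n) = monom 1 n * monom 1 1" by (simp add: mult_monom)
  ultimately show ?thesis
    by (simp only: pderiv_mult distrib_left mult_smult_right mult_smult_left mult.assoc mult.commute mult.left_commute add.commute)
qed

lemma fold_form_has_derivative:
  "(fold_form q has_derivative
     (\<lambda>w. (fst w, fst w * snd z + fst z * snd w + poly (pderiv q) (snd z) * snd w))) (at z)"
proof -
  have "((\<lambda>z. poly q (snd z)) has_derivative (\<lambda>w. poly (pderiv q) (snd z) * snd w)) (at z)"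
    by (rule has_derivative_compose[OF has_derivative_snd[OF has_derivative_ident] has_derivative_poly])
  moreover have "((\<lambda>z. fst z * snd z) has_derivative (\<lambda>w. fst z * snd w + fst w * snd z)) (at z)"
    by (rule has_derivative_mult[OF has_derivative_fst[OF has_derivative_ident] has_derivative_snd[OF has_derivative_ident]])
  ultimately have "((\<lambda>z. (fst z, fst z * snd z + poly q (snd z))) has_derivative
     (\<lambda>w. (fst w, (fst z * snd w + fst w * snd z) + poly (pderiv q) (snd z) * snd w))) (at z)"
    by (intro has_derivative_Pair has_derivative_add has_derivative_fst[OF has_derivative_ident])
  then show ?thesis by (simp add: fold_form_def case_prod_beta' add.commute add.left_commute)
qed

lemma surj_fold_form_derivative:
  "surj (frechet_derivative (fold_form q) (at z)) \<longleftrightarrow> z \<noteq> critical_curve q (snd z)"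
proof -
  obtain x y where z: "z = (x, y)" by (cases z)
  define k where "k = x + poly (pderiv q) y"
  have D: "frechet_derivative (fold_form q) (at z) = (\<lambda>w. (fst w, fst w * y + k * snd w))"
    using frechet_derivative_at[OF fold_form_has_derivative[of q z]]
    by (simp add: z k_def algebra_simps)
  have "surj (\<lambda>w::R2. (fst w, fst w * y + k * snd w)) \<longleftrightarrow> k \<noteq> 0"
  proof
    assume "surj (\<lambda>w::R2. (fst w, fst w * y + k * snd w))"
    then obtain w :: R2 where "(0, 1) = (fst w, fst w * y + k * snd w)" by (rule surjE)
    then show "k \<noteq> 0" by auto
  next
    assume "k \<noteq> 0"
    then show "surj (\<lambda>w::R2. (fst w, fst w * y + k * snd w))"
      by (intro surjI[of _ "\<lambda>v. (fst v, (snd v - fst v * y) / k)"]) simp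
  qed
  then show ?thesis
    unfolding D by (auto simp: z k_def critical_curve_def)
qed

lemma smooth_germ_critical_curve: "smooth_germ (critical_curve q)"
proof -
  have "poly (- pderiv q) = (\<lambda>t. - poly (pderiv q) t)" by (rule ext) simp
  then have "smooth_germ (\<lambda>t. - poly (pderiv q) t)" using smooth_germ_poly by metis
  then have "smooth_germ (\<lambda>t. (- poly (pderiv q) t, t))"
    by (rule smooth_germ_Pair[OF _ smooth_germ_bounded_linear[OF bounded_linear_ident]])
  then show ?thesis by (simp add: critical_curve_def[abs_def])
qed

lemma critical_curve_has_derivative:
  "(critical_curve q has_derivative (\<lambda>h. (- (poly (pderiv (pderiv q)) t * h), h))) (at t)"
  unfolding critical_curve_def[abs_def]
  by (intro has_derivative_Pair has_derivative_minus has_derivative_poly has_derivative_ident)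

text \<open>
  The velocity of the curve of critical values is \<open>- q''(t) (1, t)\<close>: the terms with \<open>q'\<close> cancel
  because the kernel of the differential along the critical curve is the \<open>y\<close>-direction. Hence the
  order of vanishing of \<open>q''\<close> is that of the velocity.
\<close>

lemma critical_values_has_derivative:
  "(critical_values q has_derivative (\<lambda>h. - (poly (pderiv (pderiv q)) t * h) *\<^sub>R (1, t))) (at t)"
proof -
  have "(critical_values q has_derivative
     (\<lambda>h. (\<lambda>w. (fst w, fst w * t + - poly (pderiv q) t * snd w + poly (pderiv q) t * snd w))
        (- (poly (pderiv (pderiv q)) t * h), h))) (at t)"
    using has_derivative_compose[OF critical_curve_has_derivative[where q=q and t=t] fold_form_has_derivative[where q=q]]
    by (simp add: critical_curve_def critical_values_def[abs_def])
  then show ?thesis by simp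
qed

lemma critical_values_monom:
  "critical_values (monom 1 (Suc n)) t = (- (real (Suc n) * t ^ n), - (real n * t ^ Suc n))"
  by (simp add: critical_values_def fold_form_def critical_curve_def pderiv_monom poly_monom algebra_simps)

lemma smooth_germ_critical_values: "smooth_germ (critical_values q)"
proof -
  have "critical_values q = (\<lambda>t. (poly (- pderiv q) t, poly (q - monom 1 1 * pderiv q) t))"
    by (rule ext) (simp add: critical_values_def fold_form_def critical_curve_def poly_monom)
  then show ?thesis using smooth_germ_Pair[OF smooth_germ_poly smooth_germ_poly] by metis
qed

section \<open>The apparent contour of a germ in fold form\<close>

text \<open>
  The data of an \<open>\<A>\<close>-equivalence of \<open>P\<close> with the fold form of \<open>q\<close>, where \<open>q\<close> vanishes to second order.
  Equivalence compares \<open>\<psi> \<circ> P \<circ> \<phi>\<close> with the normal form; continuity of \<open>P\<close> at its fixed point \<open>0\<close>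
  is what permits solving this for \<open>P\<close> itself.
\<close>

locale fold_coordinates =
  fixes P :: "R2 \<Rightarrow> R2" and \<phi> \<Phi> \<psi> \<Psi> :: "R2 \<Rightarrow> R2" and q :: "real poly"
  assumes \<phi>: "inverse_germs \<phi> \<Phi>" and \<psi>: "inverse_germs \<psi> \<Psi>"
    and normal_form: "\<forall>\<^sub>F z in nhds 0. \<psi> (P (\<phi> z)) = fold_form q z"
    and P0: "P 0 = 0" and P_cont: "isCont P 0"
    and q0: "poly q 0 = 0" and dq0: "poly (pderiv q) 0 = 0"
begin

lemma \<phi>_germ: "smooth_germ \<phi>" "smooth_germ \<Phi>" "\<phi> 0 = 0" "\<Phi> 0 = 0"
    "\<forall>\<^sub>F z in nhds 0. \<Phi> (\<phi> z) = z" "\<forall>\<^sub>F z in nhds 0. \<phi> (\<Phi> z) = z"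
  using \<phi> by (simp_all add: inverse_germs_def)

lemma \<psi>_germ: "smooth_germ \<psi>" "smooth_germ \<Psi>" "\<psi> 0 = 0" "\<Psi> 0 = 0"
    "\<forall>\<^sub>F z in nhds 0. \<Psi> (\<psi> z) = z" "\<forall>\<^sub>F z in nhds 0. \<psi> (\<Psi> z) = z"
  using \<psi> by (simp_all add: inverse_germs_def)

lemma critical_curve_0: "critical_curve q 0 = 0"
  by (simp add: critical_curve_def dq0 zero_prod_def)

lemma fold_form_0: "fold_form q 0 = 0"
  by (simp add: fold_form_def q0 zero_prod_def)

lemma eventually_smooth_compose:
  "smooth_germ f \<Longrightarrow> f 0 = 0 \<Longrightarrow> \<forall>\<^sub>F y in nhds 0. Q y \<Longrightarrow> \<forall>\<^sub>F x in nhds 0. Q (f x)"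
  using eventually_nhds_compose[OF smooth_germ_isCont, of f Q] by simp

lemma P_eq: "\<forall>\<^sub>F z in nhds 0. P z = \<Psi> (fold_form q (\<Phi> z))"
proof -
  have "\<forall>\<^sub>F z in nhds 0. \<Psi> (\<psi> (P z)) = P z"
    using \<psi>_germ(5) P0 by (intro eventually_nhds_compose[OF P_cont]) simp
  moreover have "\<forall>\<^sub>F z in nhds 0. \<psi> (P (\<phi> (\<Phi> z))) = fold_form q (\<Phi> z)"
    by (rule eventually_smooth_compose[OF \<phi>_germ(2,4) normal_form])
  ultimately show ?thesis using \<phi>_germ(6) by eventually_elim simp
qed

text \<open>
  Near \<open>0\<close> the differential of \<open>P\<close> is that of the fold form composed with isomorphisms on both
  sides, so the singular set is the preimage under \<open>\<Phi>\<close> of the critical curve.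
\<close>

lemma singular_set_iff:
  "\<forall>\<^sub>F z in nhds 0. z \<in> singular_set P \<longleftrightarrow> \<Phi> z = critical_curve q (snd (\<Phi> z))"
proof -
  have "isCont (fold_form q) (\<Phi> 0)" using fold_form_has_derivative by (rule has_derivative_continuous)
  then have c: "isCont (\<lambda>z. fold_form q (\<Phi> z)) 0"
    by (rule isCont_o2[OF smooth_germ_isCont[OF \<phi>_germ(2)]])
  have "\<forall>\<^sub>F w in nhds (fold_form q (\<Phi> 0)). \<Psi> differentiable (at w) \<and> bij (frechet_derivative \<Psi> (at w))"
    using inverse_germs_bij_derivative[OF inverse_germs_sym[OF \<psi>]] by (simp add: \<phi>_germ(4) fold_form_0)
  note eventually_nhds_compose[OF c this]
  moreover have "\<forall>\<^sub>F z in nhds 0. \<forall>\<^sub>F z' in nhds z. P z' = \<Psi> (fold_form q (\<Phi> z'))"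
    using P_eq by (simp add: eventually_eventually)
  moreover note inverse_germs_bij_derivative[OF inverse_germs_sym[OF \<phi>]]
  ultimately show ?thesis
  proof eventually_elim
    case (elim z)
    define A where "A = frechet_derivative \<Psi> (at (fold_form q (\<Phi> z)))"
    define B where "B = frechet_derivative (fold_form q) (at (\<Phi> z))"
    define C where "C = frechet_derivative \<Phi> (at z)"
    have A: "(\<Psi> has_derivative A) (at (fold_form q (\<Phi> z)))" "bij A"
      using elim(1) has_frechet_derivative[of \<Psi> "at (fold_form q (\<Phi> z))"] by (simp_all add: A_def)
    have C: "(\<Phi> has_derivative C) (at z)" "bij C"
      using elim(3) has_frechet_derivative[of \<Phi> "at z"] by (simp_all add: C_def)
    have B: "(fold_form q has_derivative B) (at (\<Phi> z))"
      unfolding B_def by (rule has_frechet_derivative[OF differentiableI[OF fold_form_has_derivative]])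
    have "((\<lambda>z. \<Psi> (fold_form q (\<Phi> z))) has_derivative (\<lambda>v. A (B (C v)))) (at z)"
      by (rule has_derivative_compose[OF has_derivative_compose[OF C(1) B] A(1)])
    moreover obtain W where "open W" "z \<in> W" "\<And>z'. z' \<in> W \<Longrightarrow> P z' = \<Psi> (fold_form q (\<Phi> z'))"
      using elim(2) by (auto simp: eventually_nhds)
    ultimately have "(P has_derivative (\<lambda>v. A (B (C v)))) (at z)"
      using has_derivative_cong_open[of W z P] by simp
    then have "frechet_derivative P (at z) = A \<circ> B \<circ> C"
      using frechet_derivative_at[symmetric] by (fastforce simp: comp_def)
    moreover have "surj (A \<circ> B \<circ> C) \<longleftrightarrow> surj B"
    proof
      assume "surj B"
      then show "surj (A \<circ> B \<circ> C)"
        using A(2) C(2) by (intro comp_surj) (simp_all add: bij_is_surj)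
    next
      assume S: "surj (A \<circ> B \<circ> C)"
      show "surj B"
      proof (rule surjI)
        fix w
        have "(A \<circ> B \<circ> C) (inv (A \<circ> B \<circ> C) (A w)) = A w" using S by (rule surj_f_inv_f)
        then show "B (C (inv (A \<circ> B \<circ> C) (A w))) = w"
          using bij_is_inj[OF A(2)] by (simp add: inj_eq)
      qed
    qed
    ultimately show ?case
      by (simp add: singular_set_def B_def surj_fold_form_derivative)
  qed
qed

lemma \<phi>_critical_curve:
  "\<forall>\<^sub>F t in nhds 0. \<Phi> (\<phi> (critical_curve q t)) = critical_curve q t"
  "\<forall>\<^sub>F t in nhds 0. \<phi> (critical_curve q t) \<in> singular_set P"
  "smooth_germ (\<lambda>t. \<phi> (critical_curve q t))"
proof -
  show sm: "smooth_germ (\<lambda>t. \<phi> (critical_curve q t))"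
    by (rule smooth_germ_compose[OF smooth_germ_critical_curve critical_curve_0 \<phi>_germ(1)])
  show id: "\<forall>\<^sub>F t in nhds 0. \<Phi> (\<phi> (critical_curve q t)) = critical_curve q t"
    by (rule eventually_smooth_compose[OF smooth_germ_critical_curve critical_curve_0 \<phi>_germ(5)])
  have "\<forall>\<^sub>F t in nhds 0. \<phi> (critical_curve q t) \<in> singular_set P \<longleftrightarrow>
      \<Phi> (\<phi> (critical_curve q t)) = critical_curve q (snd (\<Phi> (\<phi> (critical_curve q t))))"
    by (rule eventually_smooth_compose[OF sm _ singular_set_iff]) (simp add: critical_curve_0 \<phi>_germ)
  then show "\<forall>\<^sub>F t in nhds 0. \<phi> (critical_curve q t) \<in> singular_set P"
    using id by eventually_elim (simp add: critical_curve_def)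
qed

lemma critical_curve_derivative_nonzero: "frechet_derivative (\<lambda>t. \<phi> (critical_curve q t)) (at 0) 1 \<noteq> 0"
proof -
  obtain D where D: "(\<phi> has_derivative D) (at 0)" "bij D"
    by (rule inverse_germs_derivative_0[OF \<phi>])
  interpret D: bounded_linear D using D(1) by (rule has_derivative_bounded_linear)
  have "((\<lambda>t. \<phi> (critical_curve q t)) has_derivative
     (\<lambda>h. D (- (poly (pderiv (pderiv q)) 0 * h), h))) (at 0)"
    by (rule has_derivative_compose[OF critical_curve_has_derivative]) (simp add: critical_curve_0 D)
  from frechet_derivative_at[OF this, symmetric]
  have "frechet_derivative (\<lambda>t. \<phi> (critical_curve q t)) (at 0) 1 = D (- poly (pderiv (pderiv q)) 0, 1)"
    by simp
  moreover have "D (- poly (pderiv (pderiv q)) 0, 1) \<noteq> D 0"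
    using injD[OF bij_is_inj[OF D(2)], of "(- poly (pderiv (pderiv q)) 0, 1)" 0]
    by (auto simp: zero_prod_def)
  ultimately show ?thesis by simp
qed

text \<open>
  The parameter of a point \<open>z\<close> on the critical curve is the second coordinate of \<open>\<Phi> z\<close>; being defined
  and continuous off the curve as well, it cuts out a neighbourhood that matches a
  symmetric parameter interval exactly.
\<close>

lemma regular_parametrisation_critical_curve:
  "regular_parametrisation (singular_set P) (\<lambda>t. \<phi> (critical_curve q t))"
proof -
  define \<sigma> where "\<sigma> = (\<lambda>t. \<phi> (critical_curve q t))"
  define \<tau> where "\<tau> = (\<lambda>z. snd (\<Phi> z))"
  have sm: "smooth_germ \<sigma>" unfolding \<sigma>_def by (rule \<phi>_critical_curve)
  have \<sigma>0: "\<sigma> 0 = 0" by (simp add: \<sigma>_def critical_curve_0 \<phi>_germ)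
  have "\<sigma> differentiable (at 0)" using eventually_nhds_x_imp_x[OF smooth_germ_differentiable[OF sm]] .
  from frechet_derivative_eq_vector_derivative[OF this]
  have "frechet_derivative \<sigma> (at 0) 1 = vector_derivative \<sigma> (at 0)" by simp
  then have "vector_derivative \<sigma> (at 0) \<noteq> 0"
    using critical_curve_derivative_nonzero by (simp add: \<sigma>_def)
  moreover
  have "\<forall>\<^sub>F z in nhds 0. \<Phi> differentiable (at z) \<and> \<phi> (\<Phi> z) = z \<and>
      (z \<in> singular_set P \<longleftrightarrow> \<Phi> z = critical_curve q (snd (\<Phi> z)))"
    by (intro eventually_conj smooth_germ_differentiable \<phi>_germ singular_set_iff)
  then obtain N where N: "open N" "0 \<in> N" "\<And>z. z \<in> N \<Longrightarrow> \<Phi> differentiable (at z)"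
      "\<And>z. z \<in> N \<Longrightarrow> \<phi> (\<Phi> z) = z"
      "\<And>z. z \<in> N \<Longrightarrow> z \<in> singular_set P \<longleftrightarrow> \<Phi> z = critical_curve q (snd (\<Phi> z))"
    unfolding eventually_nhds by blast
  have "\<forall>\<^sub>F t in nhds 0. \<Phi> (\<sigma> t) = critical_curve q t \<and> \<sigma> t \<in> N \<and> \<sigma> differentiable (at t)"
    using eventually_smooth_compose[OF sm \<sigma>0 eventually_nhds_in_open[OF N(1,2)]]
      \<phi>_critical_curve(1) smooth_germ_differentiable[OF sm]
    by (simp add: \<sigma>_def eventually_conj_iff)
  then obtain \<delta> where \<delta>: "\<delta> > 0"
    "\<And>t. dist t 0 < \<delta> \<Longrightarrow> \<Phi> (\<sigma> t) = critical_curve q t \<and> \<sigma> t \<in> N \<and> \<sigma> differentiable (at t)"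
    unfolding eventually_nhds_metric by blast
  have in_I: "dist t 0 < \<delta> \<longleftrightarrow> t \<in> {-\<delta><..<\<delta>}" for t :: real by (auto simp: dist_real_def)
  note \<delta>' = \<delta>(2)[unfolded in_I]
  have cont: "continuous_on N \<tau>"
    unfolding \<tau>_def
    by (intro continuous_on_snd continuous_at_imp_continuous_on ballI)
       (rule differentiable_imp_continuous_within[OF N(3)])
  define U where "U = N \<inter> \<tau> -` {-\<delta><..<\<delta>}"
  have U: "open U"
    unfolding U_def using continuous_open_preimage[OF cont N(1) open_greaterThanLessThan] .
  have "homeomorphism {-\<delta><..<\<delta>} (singular_set P \<inter> U) \<sigma> \<tau>"
  proof (rule homeomorphismI)
    show "continuous_on {-\<delta><..<\<delta>} \<sigma>"
      by (intro continuous_at_imp_continuous_on ballI)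
         (rule differentiable_imp_continuous_within, use \<delta>' in blast)
    show "continuous_on (singular_set P \<inter> U) \<tau>"
      by (rule continuous_on_subset[OF cont]) (auto simp: U_def)
    show \<tau>\<sigma>: "\<tau> (\<sigma> t) = t" if "t \<in> {-\<delta><..<\<delta>}" for t
      using \<delta>'[OF that] by (simp add: \<tau>_def critical_curve_def)
    show "\<sigma> ` {-\<delta><..<\<delta>} \<subseteq> singular_set P \<inter> U"
    proof
      fix z assume "z \<in> \<sigma> ` {-\<delta><..<\<delta>}"
      then obtain t where t: "z = \<sigma> t" "t \<in> {-\<delta><..<\<delta>}" by blast
      have "\<Phi> z = critical_curve q t" "z \<in> N" using \<delta>'[OF t(2)] by (simp_all add: t(1))
      then have "z \<in> singular_set P" using N(5) by (simp add: critical_curve_def)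
      moreover have "\<tau> z = t" using \<tau>\<sigma>[OF t(2)] by (simp add: t(1))
      ultimately show "z \<in> singular_set P \<inter> U" using t(2) \<open>z \<in> N\<close> by (simp add: U_def)
    qed
    show "\<tau> ` (singular_set P \<inter> U) \<subseteq> {-\<delta><..<\<delta>}" by (auto simp: U_def)
    show "\<sigma> (\<tau> z) = z" if "z \<in> singular_set P \<inter> U" for z
    proof -
      have "z \<in> N" "z \<in> singular_set P" using that by (auto simp: U_def)
      then have "critical_curve q (\<tau> z) = \<Phi> z" using N(5) by (simp add: \<tau>_def)
      then show ?thesis using N(4)[OF \<open>z \<in> N\<close>] by (simp add: \<sigma>_def)
    qed
  qed
  ultimately show ?thesis
    unfolding regular_parametrisation_def \<sigma>_def[symmetric] using sm \<sigma>0 U \<delta>(1) by blast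
qed

text \<open>
  Two regular parametrisations of the singular set differ by a parameter change: reading the
  parameter \<open>snd \<circ> \<Phi>\<close> along \<open>\<sigma>\<close> gives \<open>s\<close>, and following \<open>\<phi> \<circ> critical_curve q\<close> by the continuous inverse of
  \<open>\<sigma>\<close> gives its inverse \<open>r\<close>. The velocity of \<open>\<Phi> \<circ> \<sigma>\<close> at \<open>0\<close> is nonzero and tangent to the critical curve,
  which has unit speed in the second coordinate; so \<open>s' 0 \<noteq> 0\<close>.
\<close>

lemma regular_parametrisation_unique:
  assumes "regular_parametrisation (singular_set P) \<sigma>"
  obtains s r where "inverse_germs s r"
    "\<forall>\<^sub>F t in nhds 0. \<Phi> (\<sigma> t) = critical_curve q (s t)"
    "\<forall>\<^sub>F t in nhds 0. \<sigma> (r t) = \<phi> (critical_curve q t)"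
proof -
  obtain \<delta> U \<tau> where \<sigma>: "smooth_germ \<sigma>" "\<sigma> 0 = 0" "vector_derivative \<sigma> (at 0) \<noteq> 0"
    and \<delta>: "\<delta> > 0" "open U" "homeomorphism {-\<delta><..<\<delta>} (singular_set P \<inter> U) \<sigma> \<tau>"
    using assms unfolding regular_parametrisation_def by blast
  note hom = \<delta>(3)[unfolded homeomorphism_def]
  define s where "s = (\<lambda>t. snd (\<Phi> (\<sigma> t)))"
  define r where "r = (\<lambda>t. \<tau> (\<phi> (critical_curve q t)))"
  have sm\<Phi>\<sigma>: "smooth_germ (\<lambda>t. \<Phi> (\<sigma> t))" by (rule smooth_germ_compose[OF \<sigma>(1,2) \<phi>_germ(2)])
  have s: "smooth_germ s" "s 0 = 0"
    unfolding s_def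
    using smooth_germ_compose[OF sm\<Phi>\<sigma> _ smooth_germ_bounded_linear[OF bounded_linear_snd]]
    by (simp_all add: \<sigma> \<phi>_germ)
  have I: "\<forall>\<^sub>F t in nhds 0. t \<in> {-\<delta><..<\<delta>}"
    using \<delta>(1) by (intro eventually_nhds_in_open) auto
  have "0 \<in> {-\<delta><..<\<delta>}" using \<delta>(1) by simp
  then have zero: "\<tau> 0 = 0" "0 \<in> singular_set P \<inter> U"
    using hom \<sigma>(2) by (metis, metis image_eqI)
  have \<phi>\<gamma>0: "\<phi> (critical_curve q 0) = 0" by (simp add: critical_curve_0 \<phi>_germ)

  have "\<forall>\<^sub>F t in nhds 0. \<sigma> t \<in> singular_set P \<longleftrightarrow> \<Phi> (\<sigma> t) = critical_curve q (snd (\<Phi> (\<sigma> t)))"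
    by (rule eventually_smooth_compose[OF \<sigma>(1,2) singular_set_iff])
  then have \<Phi>\<sigma>: "\<forall>\<^sub>F t in nhds 0. \<Phi> (\<sigma> t) = critical_curve q (s t)"
    using I
  proof eventually_elim
    case (elim t)
    have "\<sigma> t \<in> singular_set P \<inter> U" using hom elim(2) by blast
    then show ?case using elim(1) by (simp add: s_def)
  qed
  have "\<forall>\<^sub>F t in nhds 0. \<phi> (critical_curve q t) \<in> U"
    using zero \<delta>(2) by (intro eventually_smooth_compose[OF \<phi>_critical_curve(3) \<phi>\<gamma>0] eventually_nhds_in_open) simp_all
  with \<phi>_critical_curve(2)
  have SU: "\<forall>\<^sub>F t in nhds 0. \<phi> (critical_curve q t) \<in> singular_set P \<inter> U"
    by eventually_elim simp
  then have \<sigma>r: "\<forall>\<^sub>F t in nhds 0. \<sigma> (r t) = \<phi> (critical_curve q t)"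
    by eventually_elim (use hom in \<open>simp add: r_def\<close>)
  with \<phi>_critical_curve(1) have sr: "\<forall>\<^sub>F t in nhds 0. s (r t) = t"
    by eventually_elim (simp add: s_def critical_curve_def)
  have "\<forall>\<^sub>F t in nhds 0. \<phi> (\<Phi> (\<sigma> t)) = \<sigma> t"
    by (rule eventually_smooth_compose[OF \<sigma>(1,2) \<phi>_germ(6)])
  with \<Phi>\<sigma> I have rs: "\<forall>\<^sub>F t in nhds 0. r (s t) = t"
  proof eventually_elim
    case (elim t)
    have "r (s t) = \<tau> (\<sigma> t)" using elim(1,3) by (simp add: r_def)
    then show ?case using hom elim(2) by simp
  qed
  have r0: "r 0 = 0" by (simp add: r_def \<phi>\<gamma>0 zero)
  have "\<forall>\<^sub>F t in nhds 0. \<phi> (critical_curve q t) \<in> singular_set P \<inter> U \<and>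
     (\<lambda>t. \<phi> (critical_curve q t)) differentiable (at t)"
    by (intro eventually_conj SU smooth_germ_differentiable \<phi>_critical_curve)
  then obtain V where V: "open V" "0 \<in> V" "\<And>t. t \<in> V \<Longrightarrow> \<phi> (critical_curve q t) \<in> singular_set P \<inter> U"
      "\<And>t. t \<in> V \<Longrightarrow> (\<lambda>t. \<phi> (critical_curve q t)) differentiable (at t)"
    unfolding eventually_nhds by blast
  have "continuous_on V (\<lambda>t. \<phi> (critical_curve q t))"
    by (intro continuous_at_imp_continuous_on ballI) (rule differentiable_imp_continuous_within[OF V(4)])
  moreover have "continuous_on (singular_set P \<inter> U) \<tau>" using hom by blast
  moreover have "(\<lambda>t. \<phi> (critical_curve q t)) ` V \<subseteq> singular_set P \<inter> U" using V(3) by blast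
  ultimately have contr: "continuous_on V r"
    unfolding r_def by (metis continuous_on_compose2)
  have ds: "frechet_derivative s (at 0) 1 \<noteq> 0"
  proof
    assume d0: "frechet_derivative s (at 0) 1 = 0"
    have "s differentiable (at 0)" using eventually_nhds_x_imp_x[OF smooth_germ_differentiable[OF s(1)]] .
    note dS = has_frechet_derivative[OF this]
    \<comment> \<open>The derivative of \<open>\<Phi> \<circ> \<sigma> = critical_curve q \<circ> s\<close> at \<open>0\<close> is computed in both ways.\<close>
    have "((\<lambda>t. critical_curve q (s t)) has_derivative
       (\<lambda>h. (- (poly (pderiv (pderiv q)) (s 0) * frechet_derivative s (at 0) h), frechet_derivative s (at 0) h))) (at 0)"
      by (rule has_derivative_compose[OF dS critical_curve_has_derivative])
    from fun_cong[OF frechet_derivative_at[OF this], of 1]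
    have 1: "frechet_derivative (\<lambda>t. critical_curve q (s t)) (at 0) 1 = 0"
      using d0 by (simp add: zero_prod_def)
    obtain W where W: "open W" "0 \<in> W" "\<And>t. t \<in> W \<Longrightarrow> \<Phi> (\<sigma> t) = critical_curve q (s t)"
      using \<Phi>\<sigma> by (auto simp: eventually_nhds)
    have "\<sigma> differentiable (at 0)" using eventually_nhds_x_imp_x[OF smooth_germ_differentiable[OF \<sigma>(1)]] .
    note d\<sigma> = has_frechet_derivative[OF this] and v\<sigma> = frechet_derivative_eq_vector_derivative[OF this]
    obtain D where D: "(\<Phi> has_derivative D) (at 0)" "bij D"
      by (rule inverse_germs_derivative_0[OF inverse_germs_sym[OF \<phi>]])
    interpret D: bounded_linear D using D(1) by (rule has_derivative_bounded_linear)
    have "((\<lambda>t. \<Phi> (\<sigma> t)) has_derivative (\<lambda>h. D (frechet_derivative \<sigma> (at 0) h))) (at 0)"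
      by (rule has_derivative_compose[OF d\<sigma>]) (simp add: \<sigma>(2) D)
    then have "((\<lambda>t. critical_curve q (s t)) has_derivative (\<lambda>h. D (frechet_derivative \<sigma> (at 0) h))) (at 0)"
      using has_derivative_cong_open[OF W] by simp
    from fun_cong[OF frechet_derivative_at[OF this], of 1] 1
    have "D (vector_derivative \<sigma> (at 0)) = D 0" by (simp add: v\<sigma>)
    then show False using \<sigma>(3) injD[OF bij_is_inj[OF D(2)]] by blast
  qed
  have "smooth_germ r"
    by (rule smooth_germ_real_local_inverse[OF s(1) ds r0 V(1,2) contr sr])
  with s r0 sr rs have "inverse_germs s r" by (simp add: inverse_germs_def)
  from that[OF this \<Phi>\<sigma> \<sigma>r] show thesis .
qed

text \<open>
  Up to diffeomorphisms of source and target every parametrised apparent contour is the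
  curve of critical values of the normal form.
\<close>

lemma apparent_contour_normal_form:
  assumes "apparent_contour P \<gamma>"
  obtains s r where "inverse_germs s r"
    "\<forall>\<^sub>F t in nhds 0. \<psi> (\<gamma> (r t)) = critical_values q t"
    "\<forall>\<^sub>F t in nhds 0. \<gamma> t = \<Psi> (critical_values q (s t))"
proof -
  obtain \<sigma> where \<sigma>: "regular_parametrisation (singular_set P) \<sigma>" "\<gamma> = P \<circ> \<sigma>"
    using assms by (auto simp: apparent_contour_def)
  have \<sigma>': "smooth_germ \<sigma>" "\<sigma> 0 = 0"
    using \<sigma>(1) by (auto simp: regular_parametrisation_def)
  obtain s r where sr: "inverse_germs s r"
      "\<forall>\<^sub>F t in nhds 0. \<Phi> (\<sigma> t) = critical_curve q (s t)"
      "\<forall>\<^sub>F t in nhds 0. \<sigma> (r t) = \<phi> (critical_curve q t)"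
    by (rule regular_parametrisation_unique[OF \<sigma>(1)])
  have "\<forall>\<^sub>F t in nhds 0. \<psi> (P (\<phi> (critical_curve q t))) = fold_form q (critical_curve q t)"
    by (rule eventually_smooth_compose[OF smooth_germ_critical_curve critical_curve_0 normal_form])
  with sr(3) have 1: "\<forall>\<^sub>F t in nhds 0. \<psi> (\<gamma> (r t)) = critical_values q t"
    by eventually_elim (simp add: \<sigma>(2) critical_values_def)
  have "\<forall>\<^sub>F t in nhds 0. P (\<sigma> t) = \<Psi> (fold_form q (\<Phi> (\<sigma> t)))"
    by (rule eventually_smooth_compose[OF \<sigma>' P_eq])
  with sr(2) have "\<forall>\<^sub>F t in nhds 0. \<gamma> t = \<Psi> (critical_values q (s t))"
    by eventually_elim (simp add: \<sigma>(2) critical_values_def)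
  from that[OF sr(1) 1 this] show thesis .
qed

lemma cusp_apparent_contour:
  assumes "apparent_contour P \<gamma>" "inverse_germs L L'" "\<And>t. L (critical_values q t) = (t ^ k, t ^ l)"
  shows "cusp k l \<gamma>"
proof -
  obtain s r where sr: "inverse_germs s r" "\<forall>\<^sub>F t in nhds 0. \<psi> (\<gamma> (r t)) = critical_values q t"
    using apparent_contour_normal_form[OF assms(1)] by metis
  have "\<forall>\<^sub>F t in nhds 0. L (\<psi> (\<gamma> (r t))) = (t ^ k, t ^ l)"
    using sr(2) by eventually_elim (simp add: assms(3))
  moreover have "diffeo_germ r" using inverse_germs_sym[OF sr(1)] unfolding diffeo_germ_iff by blast
  moreover have "diffeo_germ (\<lambda>z. L (\<psi> z))"
    using inverse_germs_compose[OF \<psi> assms(2)] unfolding diffeo_germ_iff by blast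
  ultimately show ?thesis unfolding cusp_def A_equiv_def by blast
qed

lemma cusp_apparent_contour_monom:
  assumes "apparent_contour P \<gamma>" "q = monom 1 (Suc n)" "n > 0"
  shows "cusp n (Suc n) \<gamma>"
proof (rule cusp_apparent_contour[OF assms(1) inverse_germs_scale])
  show "- 1 / real (Suc n) \<noteq> 0" "- 1 / real n \<noteq> 0" using assms(3) by simp_all
  show "(- 1 / real (Suc n) * fst (critical_values q t), - 1 / real n * snd (critical_values q t)) = (t ^ n, t ^ Suc n)" for t
    using assms(3) unfolding assms(2) critical_values_monom by simp
qed

text \<open>
  The chain rule gives \<open>\<gamma>'(t) = D\<Psi> (- q''(s) (1, s)) s'\<close> at \<open>s = s t\<close>. Since \<open>y\<^sup>5\<close> divides \<open>q\<close>, the factor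
  \<open>q''(s)\<close> contributes \<open>s\<^sup>3\<close>, and \<open>\<gamma>'\<close> vanishes to third order.
\<close>

lemma cusp45_apparent_contour:
  assumes \<gamma>: "apparent_contour P \<gamma>" and q: "q = monom 1 5 * p"
  shows "cusp45_or_worse \<gamma>"
proof -
  obtain s r where sr: "inverse_germs s r" "\<forall>\<^sub>F t in nhds 0. \<gamma> t = \<Psi> (critical_values q (s t))"
    using apparent_contour_normal_form[OF \<gamma>] by metis
  have s: "smooth_germ s" "s 0 = 0" using sr(1) by (simp_all add: inverse_germs_def)
  obtain w where w: "pderiv (pderiv q) = monom 1 3 * w"
    using pderiv_monom_mult[of 4 p] pderiv_monom_mult[of 3] by (auto simp: q eval_nat_numeral)
  define D where "D = (\<lambda>t v. frechet_derivative \<Psi> (at (critical_values q (s t))) v)"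
  define h where "h = (\<lambda>t. (- poly w (s t) * frechet_derivative s (at t) 1) *\<^sub>R (D t (1, 0) + s t *\<^sub>R D t (0, 1)))"
  have cv0: "critical_values q (s 0) = 0"
    by (simp add: s critical_values_def critical_curve_0 fold_form_0)
  have cv: "smooth_germ (\<lambda>t. critical_values q (s t))"
    by (rule smooth_germ_compose[OF s smooth_germ_critical_values])
  have D: "smooth_germ (\<lambda>t. D t v)" for v
    unfolding D_def by (rule smooth_germ_compose[OF cv cv0 smooth_germ_derivative[OF \<psi>_germ(2)]])
  have "smooth_germ (\<lambda>t. poly (- w) (s t))"
    by (rule smooth_germ_compose[OF s smooth_germ_poly])
  then have h: "smooth_germ h"
    unfolding h_def
    by (intro smooth_germ_scaleR smooth_germ_mult smooth_germ_add D s smooth_germ_derivative) simp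
  have "\<forall>\<^sub>F t in nhds 0. \<forall>\<^sub>F t' in nhds t. \<gamma> t' = \<Psi> (critical_values q (s t'))"
    using sr(2) by (simp add: eventually_eventually)
  moreover have "\<forall>\<^sub>F t in nhds 0. \<Psi> differentiable (at (critical_values q (s t)))"
    by (rule eventually_smooth_compose[OF cv cv0 smooth_germ_differentiable[OF \<psi>_germ(2)]])
  ultimately have "\<forall>\<^sub>F t in nhds 0. frechet_derivative \<gamma> (at t) 1 = s t ^ 3 *\<^sub>R h t"
    using smooth_germ_differentiable[OF s(1)]
  proof eventually_elim
    case (elim t)
    obtain W where W: "open W" "t \<in> W" "\<And>t'. t' \<in> W \<Longrightarrow> \<gamma> t' = \<Psi> (critical_values q (s t'))"
      using elim(1) unfolding eventually_nhds by blast
    interpret D: linear "D t" unfolding D_def by (rule linear_frechet_derivative[OF elim(2)])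
    have "((\<lambda>t. \<Psi> (critical_values q (s t))) has_derivative
       (\<lambda>v. D t (- (poly (pderiv (pderiv q)) (s t) * frechet_derivative s (at t) v) *\<^sub>R (1, s t)))) (at t)"
      unfolding D_def
      by (rule has_derivative_compose[OF has_derivative_compose[OF has_frechet_derivative[OF elim(3)]
            critical_values_has_derivative] has_frechet_derivative[OF elim(2)]])
    then have "(\<gamma> has_derivative
       (\<lambda>v. D t (- (poly (pderiv (pderiv q)) (s t) * frechet_derivative s (at t) v) *\<^sub>R (1, s t)))) (at t)"
      using has_derivative_cong_open[OF W] by simp
    from fun_cong[OF frechet_derivative_at[OF this], of 1, symmetric]
    have "frechet_derivative \<gamma> (at t) 1 =
       - (s t ^ 3 * poly w (s t) * frechet_derivative s (at t) 1) *\<^sub>R D t (1, s t)"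
      by (simp only: D.scaleR w poly_mult poly_monom mult_1)
    also have "D t (1, s t) = D t (1, 0) + s t *\<^sub>R D t (0, 1)"
      by (simp flip: D.add D.scaleR)
    finally show ?case by (simp add: h_def mult.assoc)
  qed
  then have 1: "\<forall>\<^sub>F t in nhds 0. iter_deriv [1] \<gamma> t = s t ^ Suc 2 *\<^sub>R h t"
    by (simp add: eval_nat_numeral)
  obtain h2 where h2: "smooth_germ h2" "\<forall>\<^sub>F t in nhds 0. iter_deriv [1, 1] \<gamma> t = s t ^ Suc 1 *\<^sub>R h2 t"
    using flat_derivative[OF s(1) h 1] by (auto simp: eval_nat_numeral)
  obtain h3 where h3: "\<forall>\<^sub>F t in nhds 0. iter_deriv [1, 1, 1] \<gamma> t = s t ^ 1 *\<^sub>R h3 t"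
    using flat_derivative[OF s(1) h2] by auto
  show ?thesis
    using eventually_nhds_x_imp_x[OF 1] eventually_nhds_x_imp_x[OF h2(2)] eventually_nhds_x_imp_x[OF h3]
    unfolding cusp45_or_worse_def by (simp add: s(2) del: iter_deriv.simps)
qed

end

section \<open>The types in fold form\<close>

lemma A_equiv_fold_form_coordinates:
  assumes "A_equiv P (fold_form (monom 1 2 * p))" "P 0 = 0" "isCont P 0"
  shows "\<exists>\<phi> \<Phi> \<psi> \<Psi>. fold_coordinates P \<phi> \<Phi> \<psi> \<Psi> (monom 1 2 * p)"
proof -
  obtain \<phi> \<psi> where *: "diffeo_germ \<phi>" "diffeo_germ \<psi>"
      "\<forall>\<^sub>F z in nhds 0. \<psi> (P (\<phi> z)) = fold_form (monom 1 2 * p) z"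
    using assms(1) by (auto simp: A_equiv_def)
  obtain \<Phi> \<Psi> where inv: "inverse_germs \<phi> \<Phi>" "inverse_germs \<psi> \<Psi>"
    using *(1,2) by (auto simp: diffeo_germ_iff)
  have "poly (pderiv (monom 1 2 * p)) 0 = 0"
    using pderiv_monom_mult[of 1 p] by (simp add: poly_monom numeral_2_eq_2)
  then have "fold_coordinates P \<phi> \<Phi> \<psi> \<Psi> (monom 1 2 * p)"
    using inv *(3) assms(2,3) by (intro fold_coordinates.intro) (simp_all add: poly_monom)
  then show ?thesis by blast
qed

lemma type3_fold_form: "type3 P \<longleftrightarrow> A_equiv P (fold_form (monom 1 3))"
  by (simp add: type3_def fold_form_def poly_monom)

lemma type5_fold_form: "type5 P \<longleftrightarrow> A_equiv P (fold_form (monom 1 4))"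
  by (simp add: type5_def fold_form_def poly_monom)

lemma type6_or_worse_fold_form:
  assumes "type6_or_worse P" obtains p where "A_equiv P (fold_form (monom 1 5 * p))"
proof -
  have 6: "fold_form (monom 1 5 * [:1, 0, s:]) = (\<lambda>(x, y). (x, x * y + y ^ 5 + s * y ^ 7))" for s
    by (simp add: fold_form_def poly_monom algebra_simps eval_nat_numeral)
  have 7: "fold_form (monom 1 5 * 1) = (\<lambda>(x, y). (x, x * y + y ^ 5))"
    by (simp add: fold_form_def poly_monom)
  have 8: "fold_form (monom 1 5 * [:0, 1, 0, s, a:]) = (\<lambda>(x, y). (x, x * y + y ^ 6 + s * y ^ 8 + a * y ^ 9))" for s a
    by (simp add: fold_form_def poly_monom algebra_simps eval_nat_numeral)
  have 9: "fold_form (monom 1 5 * [:0, 1, 0, 0, 1:]) = (\<lambda>(x, y). (x, x * y + y ^ 6 + y ^ 9))"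
    by (simp add: fold_form_def poly_monom algebra_simps eval_nat_numeral)
  have 10: "fold_form (monom 1 5 * [:0, 0, 1, 0, s, a, b:]) =
     (\<lambda>(x, y). (x, x * y + y ^ 7 + s * y ^ 9 + a * y ^ 10 + b * y ^ 11))" for s a b
    by (simp add: fold_form_def poly_monom algebra_simps eval_nat_numeral)
  from assms that show thesis
    unfolding type6_or_worse_def type6_def type7_def type8_def type9_def type10_def
    by (elim disjE bexE exE) (simp_all only: 6[symmetric] 7[symmetric] 8[symmetric] 9[symmetric] 10[symmetric])
qed

lemma isCont_proj_germ:
  assumes "smooth_germ f1" "smooth_germ f2" shows "isCont (proj_germ \<alpha> l \<mu> \<beta> f1 f2) 0"
  unfolding proj_germ_def case_prod_beta' prod.collapse
  by (intro continuous_intros smooth_germ_isCont assms)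

text \<open>
  For a continuous plane-to-plane germ the equivalence with a normal form entails smoothness.
\<close>

theorem apparent_contour_cusps:
  assumes "P 0 = 0" "isCont P 0" "type3_or_worse P"
  shows "\<exists>\<gamma>. apparent_contour P \<gamma>"
    and "type3 P \<Longrightarrow> apparent_contour P \<gamma> \<Longrightarrow> cusp 2 3 \<gamma>"
    and "type5 P \<Longrightarrow> apparent_contour P \<gamma> \<Longrightarrow> cusp 3 4 \<gamma>"
    and "type6_or_worse P \<Longrightarrow> apparent_contour P \<gamma> \<Longrightarrow> cusp45_or_worse \<gamma>"
proof -
  have 3: "\<exists>\<phi> \<Phi> \<psi> \<Psi>. fold_coordinates P \<phi> \<Phi> \<psi> \<Psi> (monom 1 (Suc 2))" if "type3 P"
    using A_equiv_fold_form_coordinates[of P "monom 1 1"] that assms(1,2)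
    by (simp add: type3_fold_form mult_monom)
  have 5: "\<exists>\<phi> \<Phi> \<psi> \<Psi>. fold_coordinates P \<phi> \<Phi> \<psi> \<Psi> (monom 1 (Suc 3))" if "type5 P"
    using A_equiv_fold_form_coordinates[of P "monom 1 2"] that assms(1,2)
    by (simp add: type5_fold_form mult_monom)
  have 6: "\<exists>\<phi> \<Phi> \<psi> \<Psi> p. fold_coordinates P \<phi> \<Phi> \<psi> \<Psi> (monom 1 5 * p)" if P: "type6_or_worse P"
  proof -
    obtain p where p: "A_equiv P (fold_form (monom 1 5 * p))" by (rule type6_or_worse_fold_form[OF P])
    have "monom 1 5 * p = monom 1 2 * (monom 1 3 * p)" by (simp add: mult_monom flip: mult.assoc)
    with p A_equiv_fold_form_coordinates[of P "monom 1 3 * p"] assms(1,2) show ?thesis by metis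
  qed
  show "cusp 2 3 \<gamma>" if "type3 P" "apparent_contour P \<gamma>"
    using 3[OF that(1)] fold_coordinates.cusp_apparent_contour_monom[OF _ that(2), where n = 2] by fastforce
  show "cusp 3 4 \<gamma>" if "type5 P" "apparent_contour P \<gamma>"
    using 5[OF that(1)] fold_coordinates.cusp_apparent_contour_monom[OF _ that(2), where n = 3] by fastforce
  show "cusp45_or_worse \<gamma>" if "type6_or_worse P" "apparent_contour P \<gamma>"
    using 6[OF that(1)] fold_coordinates.cusp45_apparent_contour[OF _ that(2)] by blast
  have "\<exists>\<phi> \<Phi> \<psi> \<Psi> q. fold_coordinates P \<phi> \<Phi> \<psi> \<Psi> q"
    using assms(3) 3 5 6 unfolding type3_or_worse_def by blast
  then show "\<exists>\<gamma>. apparent_contour P \<gamma>"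
    unfolding apparent_contour_def using fold_coordinates.regular_parametrisation_critical_curve by blast
qed

theorem theorem9:
  fixes \<A> :: "('m::{t2_space,second_countable_topology}) chart set"
  assumes "smooth_surface \<A>"
  shows "\<exists>R. residual_in (immersion_space \<A>) R \<and>
    (\<forall>g\<in>R. \<forall>p \<pi> T f1 f2 \<alpha> l \<mu> \<beta> P.
       subspace \<pi> \<and> dim \<pi> = 2 \<and> dim (tangent_plane \<A> g p \<inter> \<pi>) = 1 \<and>
       monge_form \<A> g p T f1 f2 \<and>
       T ` \<pi> = span {(1, \<alpha>, 0, 0), (0, l, \<mu>, \<beta>)} \<and> \<mu>\<^sup>2 + \<beta>\<^sup>2 \<noteq> 0 \<and>
       P = proj_germ \<alpha> l \<mu> \<beta> f1 f2 \<and>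
       type3_or_worse P \<and> A_jet_equiv 2 P (\<lambda>(x, y). (y, x * y)) \<longrightarrow>
         (\<exists>\<gamma>. apparent_contour P \<gamma>) \<and>
         (type3 P \<longrightarrow> (\<forall>\<gamma>. apparent_contour P \<gamma> \<longrightarrow> cusp 2 3 \<gamma>)) \<and>
         (type5 P \<longrightarrow> (\<forall>\<gamma>. apparent_contour P \<gamma> \<longrightarrow> cusp 3 4 \<gamma>)) \<and>
         (type6_or_worse P \<longrightarrow> (\<forall>\<gamma>. apparent_contour P \<gamma> \<longrightarrow> cusp45_or_worse \<gamma>)))"
proof (intro exI[of _ "immersions \<A>"] conjI ballI allI impI)
  \<comment> \<open>The \<open>\<A>\<close>-type of \<open>P\<close> alone determines the contour, so every immersion qualifies.\<close>
  show "residual_in (immersion_space \<A>) (immersions \<A>)"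
    unfolding residual_in_def topspace_immersion_space by (intro conjI exI[of _ "{}"]) auto
next
  fix g :: "'m \<Rightarrow> R4" and p \<pi> T f1 f2 \<alpha> l \<mu> \<beta> and P
  assume "subspace \<pi> \<and> dim \<pi> = 2 \<and> dim (tangent_plane \<A> g p \<inter> \<pi>) = 1 \<and>
       monge_form \<A> g p T f1 f2 \<and>
       T ` \<pi> = span {(1, \<alpha>, 0, 0), (0, l, \<mu>, \<beta>)} \<and> \<mu>\<^sup>2 + \<beta>\<^sup>2 \<noteq> 0 \<and>
       P = proj_germ \<alpha> l \<mu> \<beta> f1 f2 \<and>
       type3_or_worse P \<and> A_jet_equiv 2 P (\<lambda>(x, y). (y, x * y))"
  then have monge: "monge_form \<A> g p T f1 f2" and P: "P = proj_germ \<alpha> l \<mu> \<beta> f1 f2"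
    and type: "type3_or_worse P" by blast+
  have f: "smooth_germ f1" "smooth_germ f2" "same_jet 1 f1 (\<lambda>_. 0)" "same_jet 1 f2 (\<lambda>_. 0)"
    using monge unfolding monge_form_def by blast+
  have "f1 0 = 0" "f2 0 = 0"
    using f(3,4)[unfolded same_jet_def, THEN spec[of _ "[]"]] by simp_all
  then have "P 0 = 0" by (simp add: P proj_germ_def zero_prod_def)
  moreover have "isCont P 0" unfolding P by (rule isCont_proj_germ[OF f(1,2)])
  ultimately have *: "P 0 = 0" "isCont P 0" "type3_or_worse P" using type by blast+
  show "\<exists>\<gamma>. apparent_contour P \<gamma>" by (rule apparent_contour_cusps(1)[OF *])
  show "cusp 2 3 \<gamma>" if "type3 P" "apparent_contour P \<gamma>" for \<gamma>
    by (rule apparent_contour_cusps(2)[OF * that])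
  show "cusp 3 4 \<gamma>" if "type5 P" "apparent_contour P \<gamma>" for \<gamma>
    by (rule apparent_contour_cusps(3)[OF * that])
  show "cusp45_or_worse \<gamma>" if "type6_or_worse P" "apparent_contour P \<gamma>" for \<gamma>
    by (rule apparent_contour_cusps(4)[OF * that])
qed

end
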